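(* Let $\Omega=\mathbb{R}^n$, $\mu$ the Lebesgue measure and $\Sigma$ the Lebesgue $\sigma$-algebra on $\Omega$. Let $\rho\in L^1(\mu)$ be non-negative with $\int\rho\,d\mu=1$, and let $P(\mathcal{M}):=\int\rho\mathbf{1}_\mathcal{M}\,d\mu$ for $\mathcal{M}\in\Sigma$; let $L^2(P)$ be the real Hilbert space with scalar product $(x,y)=\int xy\rho\,d\mu$. Let $\mathbf{F}:\Omega\to\Omega$ be continuously differentiable with bounded derivative, and let $\varphi:\mathbb{R}\times\Omega\to\Omega$ be its flow ($\varphi_0=\mathrm{id}$, $\varphi_{t+s}=\varphi_t\circ\varphi_s$, $\frac{d}{dt}\varphi_t(\mathbf{x})=\mathbf{F}(\varphi_t(\mathbf{x}))$). Assume $\rho\mathbf{F}\in W^{1,1}(\Omega)$ and $\omega_0:=\frac12\|\rho^{-1}\mathrm{div}(\rho\mathbf{F})\|_{L^\infty(P)}<\infty$. Then: (i) the closure in $L^2(P)$ of the operator $\mathbf{F}\cdot\boldsymbol{\nabla}$ with domain $C^1_c(\Omega)$ generates a strongly continuous group $\{\mathcal{U}(t)\}_{t\in\mathbb{R}}$ on $L^2(P)$; (ii) $\|\mathcal{U}(t)\|\le e^{\omega_0|t|}$ for all $t\in\mathbb{R}$; (iii) $\mathcal{U}(t)x=x\circ\varphi_t$ for all $x\in C^1_c(\Omega)$ and $t\in\mathbb{R}$. If in addition $\mathrm{div}(\rho\mathbf{F})=0$, then: $\mathcal{U}(t)$ is a linear isometry on $L^2(P)$ for all $t\in\mathbb{R}$;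 $P$ is invariant under $\varphi_t$ (i.e. $P=P\circ\varphi_t^{-1}$ on $\Sigma$) for all $t\in\mathbb{R}$; and $\mathcal{U}(t)x=x\circ\varphi_t$ for all $x\in L^2(P)$ and $t\in\mathbb{R}$.
   Context: $\rho^{-1}$ is well-defined $P$-almost everywhere since $\{\rho=0\}$ is a $P$-null set. $W^{1,1}$ denotes the Sobolev space and $\mathrm{div}$ the weak divergence. *)

theory Defs
  imports "HOL-Analysis.Analysis" "HOL-Probability.Probability"
begin

text \<open>Functions on R^n are modelled as functions on real^'n; elements of L^2(P)
  are represented by measurable square-integrable functions, equalities in L^2(P)
  are stated P-almost everywhere.\<close>

definition grad :: "(real^'n \<Rightarrow> real) \<Rightarrow> real^'n \<Rightarrow> real^'n" where
  "grad u x = (\<chi> i. frechet_derivative u (at x) (axis i 1))"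

definition C1c :: "(real^'n \<Rightarrow> real) \<Rightarrow> bool" where
  "C1c u \<longleftrightarrow> (\<forall>x. u differentiable (at x)) \<and> continuous_on UNIV (grad u)
      \<and> bounded {x. u x \<noteq> 0}"

definition weak_partial :: "(real^'n \<Rightarrow> real) \<Rightarrow> 'n \<Rightarrow> (real^'n \<Rightarrow> real) \<Rightarrow> bool" where
  "weak_partial u j h \<longleftrightarrow> (\<forall>\<phi>. C1c \<phi> \<longrightarrow>
      (\<integral>x. u x * grad \<phi> x $ j \<partial>lebesgue) = - (\<integral>x. h x * \<phi> x \<partial>lebesgue))"

definition W11 :: "(real^'n \<Rightarrow> real^'n) \<Rightarrow> bool" where
  "W11 G \<longleftrightarrow> (\<forall>i. integrable lebesgue (\<lambda>x. G x $ i)) \<and>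
      (\<forall>i j. \<exists>h. integrable lebesgue h \<and> weak_partial (\<lambda>x. G x $ i) j h)"

definition weak_div :: "(real^'n \<Rightarrow> real^'n) \<Rightarrow> (real^'n \<Rightarrow> real) \<Rightarrow> bool" where
  "weak_div G d \<longleftrightarrow> integrable lebesgue d \<and> (\<forall>\<phi>. C1c \<phi> \<longrightarrow>
      (\<integral>x. G x \<bullet> grad \<phi> x \<partial>lebesgue) = - (\<integral>x. d x * \<phi> x \<partial>lebesgue))"

definition L2 :: "'a measure \<Rightarrow> ('a \<Rightarrow> real) set" where
  "L2 P = {f. f \<in> borel_measurable P \<and> integrable P (\<lambda>x. (f x)\<^sup>2)}"

definition l2norm :: "'a measure \<Rightarrow> ('a \<Rightarrow> real) \<Rightarrow> real" where
  "l2norm P f = sqrt (\<integral>x. (f x)\<^sup>2 \<partial>P)"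

text \<open>Strongly continuous group of bounded linear operators on L^2(P)
  (operators act on representatives and respect a.e. equality).\<close>
definition sc_group :: "'a measure \<Rightarrow> (real \<Rightarrow> ('a \<Rightarrow> real) \<Rightarrow> ('a \<Rightarrow> real)) \<Rightarrow> bool" where
  "sc_group P U \<longleftrightarrow>
     (\<forall>t. \<forall>f\<in>L2 P. U t f \<in> L2 P) \<and>
     (\<forall>t. \<forall>f\<in>L2 P. \<forall>g\<in>L2 P. (AE x in P. f x = g x) \<longrightarrow> (AE x in P. U t f x = U t g x)) \<and>
     (\<forall>t a b. \<forall>f\<in>L2 P. \<forall>g\<in>L2 P.
        AE x in P. U t (\<lambda>y. a * f y + b * g y) x = a * U t f x + b * U t g x) \<and>
     (\<forall>t. \<exists>C. \<forall>f\<in>L2 P. l2norm P (U t f) \<le> C * l2norm P f) \<and>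
     (\<forall>f\<in>L2 P. AE x in P. U 0 f x = f x) \<and>
     (\<forall>s t. \<forall>f\<in>L2 P. AE x in P. U (s + t) f x = U s (U t f) x) \<and>
     (\<forall>f\<in>L2 P. \<forall>t0. ((\<lambda>t. l2norm P (\<lambda>x. U t f x - U t0 f x)) \<longlongrightarrow> 0) (at t0))"

definition generator_rel :: "'a measure \<Rightarrow> (real \<Rightarrow> ('a \<Rightarrow> real) \<Rightarrow> ('a \<Rightarrow> real))
    \<Rightarrow> ('a \<Rightarrow> real) \<Rightarrow> ('a \<Rightarrow> real) \<Rightarrow> bool" where
  "generator_rel P U f g \<longleftrightarrow> f \<in> L2 P \<and> g \<in> L2 P \<and>
     ((\<lambda>t. l2norm P (\<lambda>x. (U t f x - f x) / t - g x)) \<longlongrightarrow> 0) (at 0)"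

definition closure_rel :: "(real^'n) measure \<Rightarrow> (real^'n \<Rightarrow> real^'n)
    \<Rightarrow> (real^'n \<Rightarrow> real) \<Rightarrow> (real^'n \<Rightarrow> real) \<Rightarrow> bool" where
  "closure_rel P F f g \<longleftrightarrow> f \<in> L2 P \<and> g \<in> L2 P \<and>
     (\<exists>u :: nat \<Rightarrow> real^'n \<Rightarrow> real. (\<forall>k. C1c (u k)) \<and>
        (\<lambda>k. l2norm P (\<lambda>x. u k x - f x)) \<longlonglongrightarrow> 0 \<and>
        (\<lambda>k. l2norm P (\<lambda>x. F x \<bullet> grad (u k) x - g x)) \<longlonglongrightarrow> 0)"

end

theory Submission
  imports Defs
begin

text \<open>The group is \<open>U(t) f = f \<circ> \<phi> t\<close>, so everything rests on bounding the image of \<open>P\<close> under the flow.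
  The flow is \<open>C\<^sup>1\<close> in the initial point, hence \<open>u \<circ> \<phi> t\<close> is again a \<open>C\<^sup>1\<close> function of compact support for each
  such \<open>u\<close>, and \<open>m(t) = \<integral> \<rho> (u \<circ> \<phi> t)\<close> has derivative \<open>- \<integral> d (u \<circ> \<phi> t)\<close>. If \<open>\<bar>d\<bar> \<le> 2 \<omega>0 \<rho>\<close> almost
  everywhere, Gronwall gives \<open>m(t) \<le> exp (2 \<omega>0 \<bar>t\<bar>) m(0)\<close> for \<open>u \<ge> 0\<close>, and approximation extends this to
  indicators of measurable sets. The hypothesis on \<open>\<omega>0\<close> yields that bound only where \<open>\<rho> > 0\<close>; but \<open>d\<close> vanishes
  almost everywhere on \<open>\<rho> = 0\<close>: if a bounded \<open>f \<ge> 0\<close> is supported there, then \<open>\<integral> \<rho> (f \<circ> \<phi> t)\<close> is minimal at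
  \<open>t = 0\<close>, where its derivative is \<open>- \<integral> d f\<close>. That this derivative exists for discontinuous \<open>f\<close> follows from the
  strong continuity of the same group on \<open>L\<^sup>2\<close> of Lebesgue measure, whose distortion by the flow is controlled by
  the Lipschitz constant of \<open>\<phi> t\<close>. Finally, averages along the flow show that the test functions, which the group
  leaves invariant, form a core of its generator.\<close>


section \<open>Continuously differentiable functions on Euclidean space\<close>

lemma has_derivative_grad:
  fixes u :: "real^'n \<Rightarrow> real"
  assumes "u differentiable (at x)"
  shows "(u has_derivative (\<lambda>h. grad u x \<bullet> h)) (at x)"
proof -
  let ?D = "frechet_derivative u (at x)"
  have has_D: "(u has_derivative ?D) (at x)"
    using assms by (simp add: frechet_derivative_works)
  then interpret bounded_linear ?D by (rule has_derivative_bounded_linear)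
  have "?D h = grad u x \<bullet> h" for h
  proof -
    have "?D h = ?D (\<Sum>i\<in>UNIV. (h $ i) *\<^sub>R axis i 1)"
      by (simp add: basis_expansion scalar_mult_eq_scaleR[symmetric])
    also have "\<dots> = (\<Sum>i\<in>UNIV. h $ i * ?D (axis i 1))"
      by (simp add: sum scaleR)
    also have "\<dots> = grad u x \<bullet> h"
      by (simp add: grad_def inner_vec_def mult.commute)
    finally show ?thesis .
  qed
  then have "?D = (\<lambda>h. grad u x \<bullet> h)" by auto
  with has_D show ?thesis by simp
qed

lemma grad_eqI:
  fixes u :: "real^'n \<Rightarrow> real"
  assumes "(u has_derivative (\<lambda>h. G \<bullet> h)) (at x)"
  shows "grad u x = G"
  using frechet_derivative_at[OF assms, symmetric] by (simp add: grad_def vec_eq_iff inner_axis)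

lemma grad_const [simp]: "grad (\<lambda>x. c) x = 0"
  by (rule grad_eqI) simp

definition C1 :: "(real^'n \<Rightarrow> real) \<Rightarrow> bool" where
  "C1 u \<longleftrightarrow> (\<forall>x. u differentiable (at x)) \<and> continuous_on UNIV (grad u)"

lemma C1c_iff: "C1c u \<longleftrightarrow> C1 u \<and> bounded {x. u x \<noteq> 0}"
  by (auto simp: C1c_def C1_def)

lemma C1I:
  assumes deriv: "\<And>x. (u has_derivative (\<lambda>h. G x \<bullet> h)) (at x)" and "continuous_on UNIV G"
  shows "C1 u"
proof -
  have "grad u = G" using grad_eqI[OF deriv] by auto
  then show ?thesis using assms by (auto simp: C1_def differentiable_def)
qed

lemma C1_has_derivative: "C1 u \<Longrightarrow> (u has_derivative (\<lambda>h. grad u x \<bullet> h)) (at x)"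
  by (simp add: C1_def has_derivative_grad)

lemma C1_continuous_grad: "C1 u \<Longrightarrow> continuous_on S (grad u)"
  using continuous_on_subset by (auto simp: C1_def)

lemma C1_continuous: "C1 u \<Longrightarrow> continuous_on S u"
  by (meson C1_has_derivative continuous_at_imp_continuous_on has_derivative_continuous)

lemma
  assumes "C1 u" "C1 v"
  shows grad_add: "grad (\<lambda>x. u x + v x) x = grad u x + grad v x"
    and C1_add: "C1 (\<lambda>x. u x + v x)"
proof -
  have deriv: "((\<lambda>x. u x + v x) has_derivative (\<lambda>h. (grad u x + grad v x) \<bullet> h)) (at x)" for x
    using has_derivative_add[OF C1_has_derivative[OF assms(1)] C1_has_derivative[OF assms(2)]]
    by (simp add: inner_add_left)
  show "grad (\<lambda>x. u x + v x) x = grad u x + grad v x" by (rule grad_eqI[OF deriv])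
  show "C1 (\<lambda>x. u x + v x)"
    using assms by (intro C1I[OF deriv] continuous_intros C1_continuous_grad)
qed

lemma
  assumes "C1 u" "C1 v"
  shows grad_mult: "grad (\<lambda>x. u x * v x) x = u x *\<^sub>R grad v x + v x *\<^sub>R grad u x"
    and C1_mult: "C1 (\<lambda>x. u x * v x)"
proof -
  have deriv: "((\<lambda>x. u x * v x) has_derivative (\<lambda>h. (u x *\<^sub>R grad v x + v x *\<^sub>R grad u x) \<bullet> h)) (at x)" for x
    using has_derivative_mult[OF C1_has_derivative[OF assms(1)] C1_has_derivative[OF assms(2)]]
    by (simp add: inner_add_left mult.commute)
  show "grad (\<lambda>x. u x * v x) x = u x *\<^sub>R grad v x + v x *\<^sub>R grad u x" by (rule grad_eqI[OF deriv])
  show "C1 (\<lambda>x. u x * v x)"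
    using assms by (intro C1I[OF deriv] continuous_intros C1_continuous_grad C1_continuous)
qed

lemma C1_const: "C1 (\<lambda>x. c)"
  by (rule C1I[where G = "\<lambda>x. 0"]) (auto intro!: continuous_intros)

lemma C1_bounded_linear:
  assumes "bounded_linear f"
  shows "C1 f"
proof (rule C1I)
  have deriv: "(f has_derivative f) (at x)" for x
    by (rule bounded_linear.has_derivative[OF assms has_derivative_ident])
  have "(f has_derivative (\<lambda>h. grad f 0 \<bullet> h)) (at 0)"
    using deriv by (intro has_derivative_grad) (auto simp: differentiable_def)
  then have "f = (\<lambda>h. grad f 0 \<bullet> h)" using deriv has_derivative_unique by blast
  then show "(f has_derivative (\<lambda>h. grad f 0 \<bullet> h)) (at x)" for x using deriv by metis
qed (rule continuous_on_const)

lemma C1_real_polynomial_function: "real_polynomial_function p \<Longrightarrow> C1 p"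
  by (induction rule: real_polynomial_function.induct)
     (auto intro: C1_bounded_linear C1_const C1_add C1_mult)

lemma C1_compose_real:
  assumes u: "C1 u" and g: "\<And>s. (g has_real_derivative g' s) (at s)"
    and g': "continuous_on UNIV g'"
  shows "C1 (\<lambda>x. g (u x))"
proof (rule C1I[where G = "\<lambda>x. g' (u x) *\<^sub>R grad u x"])
  show "((\<lambda>x. g (u x)) has_derivative (\<lambda>h. (g' (u x) *\<^sub>R grad u x) \<bullet> h)) (at x)" for x
    using has_derivative_compose[OF C1_has_derivative[OF u] g[of "u x", unfolded has_field_derivative_def]]
    by (simp add: mult.commute)
  show "continuous_on UNIV (\<lambda>x. g' (u x) *\<^sub>R grad u x)"
    using u by (intro continuous_intros C1_continuous_grad continuous_on_compose2[OF g'] C1_continuous) auto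
qed

lemma C1_inner_self: "C1 (\<lambda>x. x \<bullet> x)"
  by (rule C1I[where G = "\<lambda>x. 2 *\<^sub>R x"])
     (auto intro!: derivative_eq_intros continuous_intros simp: inner_commute)

lemma C1_has_vector_derivative_compose:
  assumes "C1 u" and "(\<gamma> has_vector_derivative \<gamma>') (at s)"
  shows "((\<lambda>s. u (\<gamma> s)) has_real_derivative \<gamma>' \<bullet> grad u (\<gamma> s)) (at s)"
  using has_derivative_compose[OF assms(2)[unfolded has_vector_derivative_def] C1_has_derivative[OF assms(1)]]
  unfolding has_field_derivative_def
  by (rule has_derivative_eq_rhs) (auto simp: mult.commute inner_commute)

lemma has_real_derivative_pos_part_square:
  "((\<lambda>s::real. (max 0 s)\<^sup>2) has_real_derivative 2 * max 0 s) (at s)"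
proof -
  consider "s = 0" | "s > 0" | "s < 0" by linarith
  then show ?thesis
  proof cases
    assume "s = 0"
    have "((\<lambda>h. ((max 0 h)\<^sup>2 - (max 0 0)\<^sup>2) / (h - 0)) \<longlongrightarrow> (0::real)) (at 0)"
    proof (rule Lim_null_comparison)
      show "\<forall>\<^sub>F h::real in at 0. norm (((max 0 h)\<^sup>2 - (max 0 0)\<^sup>2) / (h - 0)) \<le> \<bar>h\<bar>"
        by (rule always_eventually) (auto simp: max_def power2_eq_square)
      show "((\<lambda>h::real. \<bar>h\<bar>) \<longlongrightarrow> 0) (at 0)" by (auto intro!: tendsto_eq_intros)
    qed
    then show ?thesis using \<open>s = 0\<close> by (simp add: has_field_derivative_iff)
  next
    assume "s > 0"
    then have "((\<lambda>s. s\<^sup>2) has_real_derivative 2 * max 0 s) (at s)"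
      by (auto intro!: derivative_eq_intros)
    then show ?thesis
      by (rule has_field_derivative_transform_within_open[of _ _ _ "{0<..}"]) (use \<open>s > 0\<close> in auto)
  next
    assume "s < 0"
    then have "((\<lambda>s. 0) has_real_derivative 2 * max 0 s) (at s)" by auto
    then show ?thesis
      by (rule has_field_derivative_transform_within_open[of _ _ _ "{..<0}"]) (use \<open>s < 0\<close> in auto)
  qed
qed

lemma C1_pos_part_square: "C1 u \<Longrightarrow> C1 (\<lambda>x. (max 0 (u x))\<^sup>2)"
  by (rule C1_compose_real[OF _ has_real_derivative_pos_part_square]) (auto intro!: continuous_intros)

lemma C1c_cutoff:
  fixes R :: real
  assumes "R \<ge> 0"
  obtains \<eta> :: "real^'n \<Rightarrow> real" where "C1c \<eta>" "\<And>x. 0 \<le> \<eta> x" "\<And>x. \<eta> x \<le> 1"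
    "\<And>x. norm x \<le> R \<Longrightarrow> \<eta> x = 1" "\<And>x. norm x > R + 1 \<Longrightarrow> \<eta> x = 0"
proof
  define \<eta> where "\<eta> = (\<lambda>x::real^'n. (max 0 (1 + (-1) * (max 0 (x \<bullet> x + (- R\<^sup>2)))\<^sup>2))\<^sup>2)"
  show outside: "\<eta> x = 0" if "norm x > R + 1" for x
  proof -
    have "x \<bullet> x \<ge> (R + 1)\<^sup>2" using that assms power_mono[of "R + 1" "norm x" 2]
      by (simp add: power2_norm_eq_inner)
    moreover have "(R + 1)\<^sup>2 \<ge> R\<^sup>2 + 1" using assms by (simp add: power2_eq_square algebra_simps)
    ultimately have "x \<bullet> x - R\<^sup>2 \<ge> 1" by linarith
    then have "(max 0 (x \<bullet> x + (- R\<^sup>2)))\<^sup>2 \<ge> 1" by (simp add: max_def)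
    then show ?thesis by (simp add: \<eta>_def max_def)
  qed
  have "{x. \<eta> x \<noteq> 0} \<subseteq> cball 0 (R + 1)" using outside by (force simp: not_less[symmetric])
  moreover have "C1 \<eta>" unfolding \<eta>_def
    by (intro C1_pos_part_square C1_add C1_mult C1_const C1_inner_self)
  ultimately show "C1c \<eta>"
    unfolding C1c_iff using bounded_subset[OF bounded_cball] by blast
  show "0 \<le> \<eta> x" for x by (simp add: \<eta>_def)
  show "\<eta> x \<le> 1" for x by (auto simp: \<eta>_def max_def intro!: power_le_one)
  show "\<eta> x = 1" if "norm x \<le> R" for x
  proof -
    have "x \<bullet> x \<le> R\<^sup>2" using power_mono[OF that, of 2] by (simp add: power2_norm_eq_inner)
    then show ?thesis by (simp add: \<eta>_def)
  qed
qed

lemma C1c_imp_C1: "C1c u \<Longrightarrow> C1 u"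
  by (simp add: C1c_iff)

lemma C1c_mult:
  assumes "C1c u" "C1 v" shows "C1c (\<lambda>x. u x * v x)"
  unfolding C1c_iff
proof
  show "C1 (\<lambda>x. u x * v x)" by (intro C1_mult C1c_imp_C1 assms)
  show "bounded {x. u x * v x \<noteq> 0}"
    by (rule bounded_subset[of "{x. u x \<noteq> 0}"]) (use assms in \<open>auto simp: C1c_iff\<close>)
qed

lemma grad_divide: "C1 u \<Longrightarrow> grad (\<lambda>x. u x / c) x = grad u x /\<^sub>R c"
  using grad_mult[OF _ C1_const[of "inverse c"]] by (simp add: divide_inverse)

lemma C1c_divide: "C1c u \<Longrightarrow> C1c (\<lambda>x. u x / c)"
  using C1c_mult[OF _ C1_const[of "inverse c"]] by (simp add: divide_inverse)

lemma
  assumes "\<And>i. i \<in> I \<Longrightarrow> C1 (u i)"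
  shows C1_sum: "C1 (\<lambda>x. \<Sum>i\<in>I. u i x)"
    and grad_sum: "grad (\<lambda>x. \<Sum>i\<in>I. u i x) x = (\<Sum>i\<in>I. grad (u i) x)"
proof -
  have "C1 (\<lambda>x. \<Sum>i\<in>I. u i x) \<and> (\<forall>x. grad (\<lambda>x. \<Sum>i\<in>I. u i x) x = (\<Sum>i\<in>I. grad (u i) x))"
    using assms by (induction I rule: infinite_finite_induct) (auto simp: C1_const C1_add grad_add)
  then show "C1 (\<lambda>x. \<Sum>i\<in>I. u i x)" "grad (\<lambda>x. \<Sum>i\<in>I. u i x) x = (\<Sum>i\<in>I. grad (u i) x)"
    by blast+
qed

lemma C1c_sum:
  assumes "finite I" "\<And>i. i \<in> I \<Longrightarrow> C1c (u i)"
  shows "C1c (\<lambda>x. \<Sum>i\<in>I. u i x)"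
  unfolding C1c_iff
proof
  show "C1 (\<lambda>x. \<Sum>i\<in>I. u i x)" by (intro C1_sum C1c_imp_C1 assms)
  have "{x. (\<Sum>i\<in>I. u i x) \<noteq> 0} \<subseteq> (\<Union>i\<in>I. {x. u i x \<noteq> 0})"
    by (auto intro: sum.not_neutral_contains_not_neutral)
  then show "bounded {x. (\<Sum>i\<in>I. u i x) \<noteq> 0}"
    by (rule bounded_subset[rotated]) (use assms in \<open>auto simp: C1c_iff\<close>)
qed

lemma C1c_supportE:
  assumes "C1c u"
  obtains R where "R \<ge> 0" "\<And>x. norm x > R \<Longrightarrow> u x = 0" "\<And>x. norm x > R \<Longrightarrow> grad u x = 0"
proof -
  obtain R where "\<And>x. u x \<noteq> 0 \<Longrightarrow> norm x \<le> R"
    using assms unfolding C1c_iff bounded_iff by auto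
  then have outside: "u x = 0" if "norm x > max R 0" for x using that by force
  have "grad u x = 0" if "norm x > max R 0" for x
  proof (rule grad_eqI)
    have "open {x::real^'a. norm x > max R 0}"
      by (intro open_Collect_less continuous_intros)
    then have "(u has_derivative (\<lambda>_. 0)) (at x)"
      by (rule has_derivative_transform_within_open[OF has_derivative_const]) (use that outside in auto)
    then show "(u has_derivative (\<lambda>h. 0 \<bullet> h)) (at x)" by simp
  qed
  with outside that show thesis by (metis max.cobounded2)
qed

lemma continuous_vanishing_outside_bounded:
  fixes w :: "'a::euclidean_space \<Rightarrow> 'b::real_normed_vector"
  assumes "continuous_on UNIV w" "\<And>x. norm x > R \<Longrightarrow> w x = 0"
  obtains B where "B \<ge> 0" "\<And>x. norm (w x) \<le> B"
proof -
  have "bounded (w ` cball 0 R)"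
    by (intro compact_imp_bounded compact_continuous_image continuous_on_subset[OF assms(1)]) auto
  then obtain B where "\<And>x. norm x \<le> R \<Longrightarrow> norm (w x) \<le> B"
    by (force simp: bounded_iff)
  then have "norm (w x) \<le> max B 0" for x
    using assms(2)[of x] by (cases "norm x \<le> R") (auto simp: le_max_iff_disj)
  then show thesis using that by (metis max.cobounded2)
qed

lemma C1c_boundedE:
  assumes "C1c u"
  obtains B where "B \<ge> 0" "\<And>x. \<bar>u x\<bar> \<le> B"
  using C1c_supportE[OF assms] continuous_vanishing_outside_bounded[OF C1_continuous[OF C1c_imp_C1[OF assms]]]
  by (metis real_norm_def)

lemma continuous_borel_measurable_lebesgue:
  fixes f :: "'a::euclidean_space \<Rightarrow> 'b::euclidean_space"
  shows "continuous_on UNIV f \<Longrightarrow> f \<in> borel_measurable lebesgue"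
  by (simp add: borel_measurable_continuous_onI measurable_completion)

lemma C1c_measurable: "C1c u \<Longrightarrow> u \<in> borel_measurable lebesgue"
  by (simp add: C1c_iff C1_continuous continuous_borel_measurable_lebesgue)

section \<open>Approximation of measurable functions by test functions\<close>

definition clip :: "real \<Rightarrow> real \<Rightarrow> real" where
  "clip B y = max (- B) (min B y)"

lemma abs_clip_le: "B \<ge> 0 \<Longrightarrow> \<bar>clip B y\<bar> \<le> B"
  by (auto simp: clip_def)

lemma clip_eq: "\<bar>y\<bar> \<le> B \<Longrightarrow> clip B y = y"
  by (auto simp: clip_def)

lemma abs_clip_le_abs: "B \<ge> 0 \<Longrightarrow> \<bar>clip B y\<bar> \<le> \<bar>y\<bar>"
  by (auto simp: clip_def)

lemma abs_diff_clip_le: "B \<ge> 0 \<Longrightarrow> \<bar>y - clip B y\<bar> \<le> \<bar>y\<bar>"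
  by (auto simp: clip_def)

lemma eventually_clip_eq: "\<forall>\<^sub>F n in sequentially. clip (real n) y = y"
proof -
  obtain N where "\<bar>y\<bar> \<le> real N" using real_arch_simple by blast
  then show ?thesis
    by (intro eventually_sequentiallyI[of N] clip_eq) (meson of_nat_le_iff order_trans)
qed

lemma continuous_on_clip: "continuous_on S f \<Longrightarrow> continuous_on S (\<lambda>x. clip B (f x))"
  unfolding clip_def by (intro continuous_intros)

lemma borel_measurable_clip [measurable]: "f \<in> borel_measurable M \<Longrightarrow> (\<lambda>x. clip B (f x)) \<in> borel_measurable M"
  unfolding clip_def by (intro borel_measurable_max borel_measurable_min borel_measurable_const)

lemma tendsto_clip: "(f \<longlongrightarrow> l) net \<Longrightarrow> ((\<lambda>x. clip B (f x)) \<longlongrightarrow> clip B l) net"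
  unfolding clip_def by (intro tendsto_intros)

lemma continuous_cutoff_approx_C1c:
  fixes g :: "real^'n \<Rightarrow> real"
  assumes "continuous_on UNIV g" "e > 0"
    and \<eta>: "C1c \<eta>" "\<And>x. 0 \<le> \<eta> x" "\<And>x. \<eta> x \<le> 1"
  obtains p where "C1c (\<lambda>x. \<eta> x * p x)" "\<And>x. \<bar>\<eta> x * p x - \<eta> x * g x\<bar> \<le> e"
proof -
  obtain R where support: "\<And>x. norm x > R \<Longrightarrow> \<eta> x = 0" by (rule C1c_supportE[OF \<eta>(1)]) (rule that)
  obtain p where p: "real_polynomial_function p" "\<And>x. x \<in> cball 0 R \<Longrightarrow> \<bar>g x - p x\<bar> < e"
    using Stone_Weierstrass_real_polynomial_function[OF compact_cball continuous_on_subset[OF assms(1)] \<open>e > 0\<close>]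
    by (metis subset_UNIV)
  show thesis
  proof
    show "C1c (\<lambda>x. \<eta> x * p x)"
      by (intro C1c_mult \<eta> C1_real_polynomial_function p)
    show "\<bar>\<eta> x * p x - \<eta> x * g x\<bar> \<le> e" for x
    proof (cases "norm x \<le> R")
      case True
      have "\<bar>\<eta> x\<bar> * \<bar>p x - g x\<bar> \<le> 1 * e"
        using p(2)[of x] True \<eta>(2,3)[of x] by (intro mult_mono) auto
      then show ?thesis by (simp add: abs_mult[symmetric] right_diff_distrib)
    qed (use support[of x] \<open>e > 0\<close> in auto)
  qed
qed

lemma lebesgue_measurable_AE_limit_continuous:
  fixes f :: "'a::euclidean_space \<Rightarrow> real"
  assumes "f \<in> borel_measurable lebesgue"
  obtains g where "\<And>n::nat. continuous_on UNIV (g n)" "AE x in lebesgue. (\<lambda>n. g n x) \<longlonglongrightarrow> f x"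
proof -
  have "f measurable_on UNIV"
    using assms by (simp add: lebesgue_measurable_imp_measurable_on)
  then obtain N g where N: "negligible N" and g: "\<And>n::nat. continuous_on UNIV (g n)"
    and lim: "\<And>x. x \<notin> N \<Longrightarrow> (\<lambda>n. g n x) \<longlonglongrightarrow> f x"
    unfolding measurable_on_def by auto
  have "N \<in> null_sets lebesgue" using N by (simp add: negligible_iff_null_sets)
  then have "AE x in lebesgue. (\<lambda>n. g n x) \<longlonglongrightarrow> f x"
    by (rule AE_I') (use lim in auto)
  with g that show thesis by blast
qed

lemma bounded_measurable_approx_C1c:
  fixes f :: "real^'n \<Rightarrow> real"
  assumes f: "f \<in> borel_measurable lebesgue" "\<And>x. \<bar>f x\<bar> \<le> B" "\<And>x. norm x > R \<Longrightarrow> f x = 0"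
    and "R \<ge> 0"
  obtains u where "\<And>k::nat. C1c (u k)" "\<And>k x. \<bar>u k x\<bar> \<le> B + 1" "\<And>k x. norm x > R + 1 \<Longrightarrow> u k x = 0"
    "AE x in lebesgue. (\<lambda>k. u k x) \<longlonglongrightarrow> f x"
proof -
  have "B \<ge> 0" using f(2)[of 0] by linarith
  obtain g where g: "\<And>n::nat. continuous_on UNIV (g n)" "AE x in lebesgue. (\<lambda>n. g n x) \<longlonglongrightarrow> f x"
    by (rule lebesgue_measurable_AE_limit_continuous[OF f(1)]) (rule that)
  obtain \<eta> :: "real^'n \<Rightarrow> real" where \<eta>: "C1c \<eta>" "\<And>x. 0 \<le> \<eta> x" "\<And>x. \<eta> x \<le> 1"
    "\<And>x. norm x \<le> R \<Longrightarrow> \<eta> x = 1" "\<And>x. norm x > R + 1 \<Longrightarrow> \<eta> x = 0"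
    by (rule C1c_cutoff[OF \<open>R \<ge> 0\<close>]) (rule that)
  have "\<exists>p. C1c (\<lambda>x. \<eta> x * p x) \<and> (\<forall>x. \<bar>\<eta> x * p x - \<eta> x * clip B (g k x)\<bar> \<le> 1 / real (Suc k))" for k
    by (rule continuous_cutoff_approx_C1c[OF continuous_on_clip[OF g(1)] _ \<eta>(1-3)]) auto
  then obtain p where p: "\<And>k. C1c (\<lambda>x. \<eta> x * p k x)"
    "\<And>k x. \<bar>\<eta> x * p k x - \<eta> x * clip B (g k x)\<bar> \<le> 1 / real (Suc k)"
    by metis
  show thesis
  proof
    show "C1c (\<lambda>x. \<eta> x * p k x)" for k by (rule p)
    show "\<eta> x * p k x = 0" if "norm x > R + 1" for k x using \<eta>(5)[OF that] by simp
    show "\<bar>\<eta> x * p k x\<bar> \<le> B + 1" for k x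
    proof -
      have "\<bar>\<eta> x\<bar> * \<bar>clip B (g k x)\<bar> \<le> 1 * B"
        using \<eta>(2,3) abs_clip_le[OF \<open>B \<ge> 0\<close>] by (intro mult_mono) auto
      moreover have "1 / real (Suc k) \<le> 1" by simp
      ultimately show ?thesis using p(2)[of x k] unfolding abs_mult[symmetric] by linarith
    qed
    show "AE x in lebesgue. (\<lambda>k. \<eta> x * p k x) \<longlonglongrightarrow> f x"
      using g(2)
    proof eventually_elim
      case (elim x)
      have "(\<lambda>k. \<eta> x * p k x - \<eta> x * clip B (g k x)) \<longlonglongrightarrow> 0"
        by (rule Lim_null_comparison[OF always_eventually LIMSEQ_Suc[OF lim_1_over_n]]) (use p(2) in auto)
      from tendsto_add[OF this tendsto_mult_left[OF tendsto_clip[OF elim, of B], of "\<eta> x"]]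
      have "(\<lambda>k. \<eta> x * p k x) \<longlonglongrightarrow> \<eta> x * clip B (f x)" by simp
      also have "\<eta> x * clip B (f x) = f x"
        unfolding clip_eq[OF f(2)] using f(3)[of x] \<eta>(4)[of x] by (cases "norm x \<le> R") auto
      finally show ?case .
    qed
  qed
qed

section \<open>Square-integrable functions\<close>

lemma integral_dominated_convergence_at:
  fixes s :: "'a::first_countable_topology \<Rightarrow> 'b \<Rightarrow> 'c::{banach, second_countable_topology}"
  assumes f: "f \<in> borel_measurable M" and s: "\<And>h. s h \<in> borel_measurable M"
    and w: "integrable M w"
    and lim: "AE x in M. ((\<lambda>h. s h x) \<longlongrightarrow> f x) (at a within S)"
    and bound: "\<forall>\<^sub>F h in at a within S. AE x in M. norm (s h x) \<le> w x"
  shows "((\<lambda>h. \<integral>x. s h x \<partial>M) \<longlongrightarrow> (\<integral>x. f x \<partial>M)) (at a within S)"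
  unfolding tendsto_at_iff_sequentially
proof (intro allI impI)
  fix X assume X: "\<forall>i. X i \<in> S - {a}" "X \<longlonglongrightarrow> a"
  then have X_at: "filterlim X (at a within S) sequentially"
    by (auto simp: filterlim_at intro: always_eventually)
  then obtain N where N: "\<And>n. n \<ge> N \<Longrightarrow> AE x in M. norm (s (X n) x) \<le> w x"
    using filterlim_iff[THEN iffD1, OF X_at, rule_format, OF bound]
    by (auto simp: eventually_sequentially)
  have "(\<lambda>n. \<integral>x. s (X (n + N)) x \<partial>M) \<longlonglongrightarrow> (\<integral>x. f x \<partial>M)"
  proof (rule integral_dominated_convergence[OF f s w])
    show "AE x in M. (\<lambda>n. s (X (n + N)) x) \<longlonglongrightarrow> f x"
      using lim by eventually_elim (intro LIMSEQ_ignore_initial_segment filterlim_compose[OF _ X_at])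
    show "AE x in M. norm (s (X (n + N)) x) \<le> w x" for n
      by (rule N) simp
  qed
  then show "((\<lambda>h. \<integral>x. s h x \<partial>M) \<circ> X) \<longlonglongrightarrow> (\<integral>x. f x \<partial>M)"
    unfolding o_def by (rule LIMSEQ_offset)
qed

lemma LIMSEQ_null_lessE:
  fixes X :: "nat \<Rightarrow> real"
  assumes "X \<longlonglongrightarrow> 0" "e > 0"
  obtains n where "n > 0" "X n < e"
proof -
  have "\<forall>\<^sub>F n in sequentially. n > 0 \<and> X n < e"
    using eventually_gt_at_top order_tendstoD(2)[OF assms] by (rule eventually_conj)
  then show thesis using that eventually_happens'[OF sequentially_bot] by blast
qed

lemma L2_measurable: "f \<in> L2 M \<Longrightarrow> f \<in> borel_measurable M"
  by (simp add: L2_def)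

lemma L2_integrable_square: "f \<in> L2 M \<Longrightarrow> integrable M (\<lambda>x. (f x)\<^sup>2)"
  by (simp add: L2_def)

lemma L2_zero: "(\<lambda>x. 0) \<in> L2 M"
  by (simp add: L2_def)

lemma L2_bound:
  assumes "f \<in> borel_measurable M" "g \<in> L2 M" "\<And>x. \<bar>f x\<bar> \<le> \<bar>g x\<bar>"
  shows "f \<in> L2 M"
  unfolding L2_def
proof (intro CollectI conjI assms(1))
  show "integrable M (\<lambda>x. (f x)\<^sup>2)"
    by (rule Bochner_Integration.integrable_bound[OF L2_integrable_square[OF assms(2)]])
      (use assms in \<open>auto simp: abs_le_square_iff\<close>)
qed

lemma L2_mult_integrable:
  assumes "f \<in> L2 M" "g \<in> L2 M"
  shows "integrable M (\<lambda>x. f x * g x)"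
proof (rule Bochner_Integration.integrable_bound)
  show "integrable M (\<lambda>x. (f x)\<^sup>2 + (g x)\<^sup>2)" using assms by (auto simp: L2_def)
  show "(\<lambda>x. f x * g x) \<in> borel_measurable M" using assms by (auto simp: L2_def)
  show "AE x in M. norm (f x * g x) \<le> norm ((f x)\<^sup>2 + (g x)\<^sup>2)"
  proof (rule AE_I2)
    fix x
    have "2 * (\<bar>f x\<bar> * \<bar>g x\<bar>) \<le> (f x)\<^sup>2 + (g x)\<^sup>2"
      using sum_squares_bound[of "\<bar>f x\<bar>" "\<bar>g x\<bar>"] by (simp add: mult.assoc)
    moreover have "0 \<le> \<bar>f x\<bar> * \<bar>g x\<bar>" by simp
    ultimately have "\<bar>f x\<bar> * \<bar>g x\<bar> \<le> (f x)\<^sup>2 + (g x)\<^sup>2" by linarith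
    then show "norm (f x * g x) \<le> norm ((f x)\<^sup>2 + (g x)\<^sup>2)" by (simp add: abs_mult)
  qed
qed

lemma L2_add:
  assumes "f \<in> L2 M" "g \<in> L2 M"
  shows "(\<lambda>x. f x + g x) \<in> L2 M"
proof -
  have "integrable M (\<lambda>x. (f x)\<^sup>2 + (g x)\<^sup>2 + 2 * (f x * g x))"
    using assms L2_mult_integrable[OF assms] by (auto simp: L2_def)
  then have "integrable M (\<lambda>x. (f x + g x)\<^sup>2)" by (simp add: power2_sum mult.assoc)
  then show ?thesis using assms by (auto simp: L2_def)
qed

lemma L2_scale: "f \<in> L2 M \<Longrightarrow> (\<lambda>x. c * f x) \<in> L2 M"
  by (auto simp: L2_def power_mult_distrib)

lemma L2_diff: "f \<in> L2 M \<Longrightarrow> g \<in> L2 M \<Longrightarrow> (\<lambda>x. f x - g x) \<in> L2 M"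
  using L2_add[OF _ L2_scale[of g M "-1"], of f] by simp

lemma L2_divide: "f \<in> L2 M \<Longrightarrow> (\<lambda>x. f x / c) \<in> L2 M"
  using L2_scale[of f M "1 / c"] by simp

lemma L2_sum: "(\<And>i. i \<in> I \<Longrightarrow> f i \<in> L2 M) \<Longrightarrow> (\<lambda>x. \<Sum>i\<in>I. f i x) \<in> L2 M"
  by (induction I rule: infinite_finite_induct) (auto intro: L2_zero L2_add)

lemma l2norm_nonneg [simp]: "l2norm M f \<ge> 0"
  by (simp add: l2norm_def)

lemma l2norm_zero [simp]: "l2norm M (\<lambda>x. 0) = 0"
  by (simp add: l2norm_def)

lemma l2norm_square: "(l2norm M f)\<^sup>2 = (\<integral>x. (f x)\<^sup>2 \<partial>M)"
  by (simp add: l2norm_def)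

lemma l2norm_divide: "l2norm M (\<lambda>x. f x / c) = l2norm M f / \<bar>c\<bar>"
  by (simp add: l2norm_def power_divide real_sqrt_divide)

lemma l2norm_minus_commute: "l2norm M (\<lambda>x. f x - g x) = l2norm M (\<lambda>x. g x - f x)"
  by (simp add: l2norm_def power2_commute)

lemma l2norm_Cauchy_Schwarz:
  assumes f: "f \<in> L2 M" and g: "g \<in> L2 M"
  shows "\<bar>\<integral>x. f x * g x \<partial>M\<bar> \<le> l2norm M f * l2norm M g"
proof -
  have nn_square: "(\<integral>\<^sup>+x. (ennreal \<bar>h x\<bar>)\<^sup>2 \<partial>M) = ennreal ((l2norm M h)\<^sup>2)" if "h \<in> L2 M" for h
    using nn_integral_eq_integral[OF L2_integrable_square[OF that]]
    by (simp add: ennreal_power l2norm_square)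
  have "integrable M (\<lambda>x. \<bar>f x\<bar> * \<bar>g x\<bar>)"
    using integrable_abs[OF L2_mult_integrable[OF f g]] by (simp add: abs_mult)
  then have "ennreal ((\<integral>x. \<bar>f x\<bar> * \<bar>g x\<bar> \<partial>M)\<^sup>2) = (\<integral>\<^sup>+x. ennreal \<bar>f x\<bar> * ennreal \<bar>g x\<bar> \<partial>M)\<^sup>2"
    by (subst ennreal_power[symmetric]) (simp_all add: nn_integral_eq_integral ennreal_mult[symmetric])
  also have "\<dots> \<le> ennreal ((l2norm M f)\<^sup>2) * ennreal ((l2norm M g)\<^sup>2)"
    using Cauchy_Schwarz_nn_integral[of "\<lambda>x. ennreal \<bar>f x\<bar>" M "\<lambda>x. ennreal \<bar>g x\<bar>"]
      L2_measurable[OF f] L2_measurable[OF g] by (simp add: nn_square f g)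
  finally have "(\<integral>x. \<bar>f x\<bar> * \<bar>g x\<bar> \<partial>M)\<^sup>2 \<le> (l2norm M f * l2norm M g)\<^sup>2"
    by (simp add: ennreal_mult[symmetric] power_mult_distrib)
  then have "(\<integral>x. \<bar>f x\<bar> * \<bar>g x\<bar> \<partial>M) \<le> l2norm M f * l2norm M g"
    by (rule power2_le_imp_le) simp
  then show ?thesis
    using integral_abs_bound[of M "\<lambda>x. f x * g x"] by (simp add: abs_mult)
qed

lemma l2norm_triangle:
  assumes f: "f \<in> L2 M" and g: "g \<in> L2 M"
  shows "l2norm M (\<lambda>x. f x + g x) \<le> l2norm M f + l2norm M g"
proof (rule power2_le_imp_le)
  have "(l2norm M (\<lambda>x. f x + g x))\<^sup>2 = (\<integral>x. (f x)\<^sup>2 + (g x)\<^sup>2 + 2 * (f x * g x) \<partial>M)"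
    by (simp add: l2norm_square power2_sum mult.assoc)
  also have "\<dots> = (l2norm M f)\<^sup>2 + (l2norm M g)\<^sup>2 + 2 * (\<integral>x. f x * g x \<partial>M)"
    using f g L2_mult_integrable[OF f g] by (simp add: L2_def l2norm_square)
  also have "\<dots> \<le> (l2norm M f)\<^sup>2 + (l2norm M g)\<^sup>2 + 2 * (l2norm M f * l2norm M g)"
    using l2norm_Cauchy_Schwarz[OF f g] by linarith
  also have "\<dots> = (l2norm M f + l2norm M g)\<^sup>2" by (simp add: power2_sum mult.assoc)
  finally show "(l2norm M (\<lambda>x. f x + g x))\<^sup>2 \<le> (l2norm M f + l2norm M g)\<^sup>2" .
qed simp

lemma l2norm_diff_triangle:
  assumes "f \<in> L2 M" "g \<in> L2 M" "h \<in> L2 M"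
  shows "l2norm M (\<lambda>x. f x - h x) \<le> l2norm M (\<lambda>x. f x - g x) + l2norm M (\<lambda>x. g x - h x)"
  using l2norm_triangle[OF L2_diff[OF assms(1,2)] L2_diff[OF assms(2,3)]] by simp

lemma l2norm_diff_le:
  assumes "f \<in> L2 M" "g \<in> L2 M"
  shows "l2norm M (\<lambda>x. f x - g x) \<le> l2norm M f + l2norm M g"
  using l2norm_diff_triangle[OF assms(1) L2_zero assms(2)] l2norm_minus_commute[of M "\<lambda>x. 0" g] by simp

lemma l2norm_sum_le:
  "(\<And>i. i \<in> I \<Longrightarrow> f i \<in> L2 M) \<Longrightarrow> l2norm M (\<lambda>x. \<Sum>i\<in>I. f i x) \<le> (\<Sum>i\<in>I. l2norm M (f i))"
proof (induction I rule: infinite_finite_induct)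
  case (insert i I)
  have "l2norm M (\<lambda>x. f i x + (\<Sum>i\<in>I. f i x)) \<le> l2norm M (f i) + l2norm M (\<lambda>x. \<Sum>i\<in>I. f i x)"
    using insert by (intro l2norm_triangle L2_sum) auto
  then show ?case using insert by force
qed simp_all

lemma l2norm_average_le:
  assumes "n > 0" "\<And>j. j < n \<Longrightarrow> f j \<in> L2 M" "\<And>j. j < n \<Longrightarrow> l2norm M (f j) \<le> b"
  shows "l2norm M (\<lambda>x. (\<Sum>j<n. f j x) / real n) \<le> b"
proof -
  have "l2norm M (\<lambda>x. \<Sum>j<n. f j x) \<le> (\<Sum>j<n. l2norm M (f j))"
    using assms by (intro l2norm_sum_le) auto
  also have "\<dots> \<le> real n * b" using sum_bounded_above[of "{..<n}" "\<lambda>j. l2norm M (f j)" b] assms by simp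
  finally show ?thesis using \<open>n > 0\<close> by (simp add: l2norm_divide divide_le_eq mult.commute)
qed

lemma l2norm_dominated_convergence:
  assumes f: "\<And>k::nat. f k \<in> borel_measurable M" and w: "w \<in> L2 M"
    and lim: "AE x in M. (\<lambda>k. f k x) \<longlonglongrightarrow> 0" and bound: "\<And>k x. \<bar>f k x\<bar> \<le> \<bar>w x\<bar>"
  shows "(\<lambda>k. l2norm M (f k)) \<longlonglongrightarrow> 0"
proof -
  have "(\<lambda>k. \<integral>x. (f k x)\<^sup>2 \<partial>M) \<longlonglongrightarrow> (\<integral>x. 0 \<partial>M)"
  proof (rule integral_dominated_convergence[OF _ _ L2_integrable_square[OF w]])
    show "AE x in M. (\<lambda>k. (f k x)\<^sup>2) \<longlonglongrightarrow> 0"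
      using lim by eventually_elim (auto intro: tendsto_eq_intros)
    show "AE x in M. norm ((f k x)\<^sup>2) \<le> (w x)\<^sup>2" for k
      using bound by (intro AE_I2) (simp add: abs_le_square_iff[symmetric])
  qed (use f in auto)
  then show ?thesis unfolding l2norm_def using tendsto_real_sqrt by fastforce
qed

lemma l2norm_dominated_convergence_at:
  fixes f :: "'a::first_countable_topology \<Rightarrow> 'b \<Rightarrow> real"
  assumes f: "\<And>h. f h \<in> borel_measurable M" and w: "w \<in> L2 M"
    and lim: "\<And>x. ((\<lambda>h. f h x) \<longlongrightarrow> 0) (at a within S)"
    and bound: "\<forall>\<^sub>F h in at a within S. \<forall>x. \<bar>f h x\<bar> \<le> \<bar>w x\<bar>"
  shows "((\<lambda>h. l2norm M (f h)) \<longlongrightarrow> 0) (at a within S)"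
proof -
  have "((\<lambda>h. \<integral>x. (f h x)\<^sup>2 \<partial>M) \<longlongrightarrow> (\<integral>x. 0 \<partial>M)) (at a within S)"
  proof (rule integral_dominated_convergence_at[OF _ _ L2_integrable_square[OF w]])
    show "AE x in M. ((\<lambda>h. (f h x)\<^sup>2) \<longlongrightarrow> 0) (at a within S)"
      by (rule AE_I2) (auto intro: tendsto_eq_intros lim)
    show "\<forall>\<^sub>F h in at a within S. AE x in M. norm ((f h x)\<^sup>2) \<le> (w x)\<^sup>2"
      using bound by eventually_elim (simp add: abs_le_square_iff[symmetric])
  qed (use f in auto)
  then show ?thesis unfolding l2norm_def using tendsto_real_sqrt by fastforce
qed

lemma clip_L2:
  assumes "integrable M f" "B \<ge> 0"
  shows "(\<lambda>x. clip B (f x)) \<in> L2 M"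
  unfolding L2_def
proof (intro CollectI conjI)
  have f: "f \<in> borel_measurable M" using assms by auto
  show clip_f: "(\<lambda>x. clip B (f x)) \<in> borel_measurable M" by (rule borel_measurable_clip[OF f])
  show "integrable M (\<lambda>x. (clip B (f x))\<^sup>2)"
  proof (rule Bochner_Integration.integrable_bound)
    show "integrable M (\<lambda>x. B * f x)" by (rule integrable_mult_right[OF assms(1)])
    show "(\<lambda>x. (clip B (f x))\<^sup>2) \<in> borel_measurable M" by (rule borel_measurable_power[OF clip_f])
    have "\<bar>clip B (f x)\<bar> * \<bar>clip B (f x)\<bar> \<le> B * \<bar>f x\<bar>" for x
      using abs_clip_le abs_clip_le_abs \<open>B \<ge> 0\<close> by (intro mult_mono) auto
    then show "AE x in M. norm ((clip B (f x))\<^sup>2) \<le> norm (B * f x)"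
      using \<open>B \<ge> 0\<close> by (intro AE_I2) (simp add: power2_eq_square abs_mult)
  qed
qed

lemma clip_tendsto_L1:
  assumes "integrable M f"
  shows "(\<lambda>n. \<integral>x. \<bar>f x - clip (real n) (f x)\<bar> \<partial>M) \<longlonglongrightarrow> 0"
proof -
  have f: "f \<in> borel_measurable M" using assms by auto
  have "(\<lambda>n. \<integral>x. \<bar>f x - clip (real n) (f x)\<bar> \<partial>M) \<longlonglongrightarrow> (\<integral>x. 0 \<partial>M)"
  proof (rule integral_dominated_convergence[OF _ _ integrable_abs[OF assms]])
    show "AE x in M. (\<lambda>n. \<bar>f x - clip (real n) (f x)\<bar>) \<longlonglongrightarrow> 0"
    proof (rule AE_I2)
      fix x
      have "\<forall>\<^sub>F n in sequentially. \<bar>f x - clip (real n) (f x)\<bar> = 0"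
        using eventually_clip_eq[of "f x"] by eventually_elim simp
      then show "(\<lambda>n. \<bar>f x - clip (real n) (f x)\<bar>) \<longlonglongrightarrow> 0" by (rule tendsto_eventually)
    qed
  qed (use f in \<open>auto simp: abs_diff_clip_le intro: borel_measurable_clip\<close>)
  then show ?thesis by simp
qed

lemma integrable_mult_bounded:
  fixes d w :: "'a \<Rightarrow> real"
  assumes d: "integrable M d" and w: "w \<in> borel_measurable M" "\<And>x. \<bar>w x\<bar> \<le> B"
  shows "integrable M (\<lambda>x. d x * w x)"
proof (rule Bochner_Integration.integrable_bound[OF integrable_mult_left[OF d, of B]])
  show "(\<lambda>x. d x * w x) \<in> borel_measurable M" using d w by auto
  have "\<bar>d x\<bar> * \<bar>w x\<bar> \<le> \<bar>d x\<bar> * \<bar>B\<bar>" for x using w(2)[of x] by (intro mult_left_mono) auto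
  then show "AE x in M. norm (d x * w x) \<le> norm (d x * B)" by (simp add: abs_mult)
qed

lemma L1_pairing_L2_bound:
  assumes d: "integrable M d" and "e > 0"
  obtains C where "C \<ge> 0"
    "\<And>w B. w \<in> L2 M \<Longrightarrow> (\<And>x. \<bar>w x\<bar> \<le> B) \<Longrightarrow> \<bar>\<integral>x. d x * w x \<partial>M\<bar> \<le> e * B + C * l2norm M w"
proof -
  obtain n where n: "(\<integral>x. \<bar>d x - clip (real n) (d x)\<bar> \<partial>M) < e"
    by (rule LIMSEQ_null_lessE[OF clip_tendsto_L1[OF d] \<open>e > 0\<close>]) (rule that)
  define d' where "d' x = clip (real n) (d x)" for x
  have d': "d' \<in> L2 M" unfolding d'_def by (rule clip_L2[OF d]) simp
  show thesis
  proof (rule that[of "l2norm M d'"])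
    fix w B assume w: "w \<in> L2 M" "\<And>x. \<bar>w x\<bar> \<le> B"
    have diff: "integrable M (\<lambda>x. d x - d' x)"
      by (rule Bochner_Integration.integrable_bound[OF d])
        (use d L2_measurable[OF d'] in \<open>auto simp: d'_def abs_diff_clip_le\<close>)
    have rest: "integrable M (\<lambda>x. (d x - d' x) * w x)"
      by (rule integrable_mult_bounded[OF diff L2_measurable[OF w(1)] w(2)])
    have "(\<integral>x. d x * w x \<partial>M) = (\<integral>x. (d x - d' x) * w x \<partial>M) + (\<integral>x. d' x * w x \<partial>M)"
      using Bochner_Integration.integral_add[OF rest L2_mult_integrable[OF d' w(1)]]
      by (simp add: left_diff_distrib)
    moreover have "\<bar>\<integral>x. (d x - d' x) * w x \<partial>M\<bar> \<le> e * B"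
    proof -
      have "\<bar>\<integral>x. (d x - d' x) * w x \<partial>M\<bar> \<le> (\<integral>x. \<bar>(d x - d' x) * w x\<bar> \<partial>M)"
        by (rule integral_abs_bound)
      also have "\<dots> \<le> (\<integral>x. \<bar>d x - d' x\<bar> * B \<partial>M)"
        using w(2) by (intro integral_mono integrable_abs rest integrable_mult_left diff)
          (auto simp: abs_mult intro: mult_left_mono)
      also have "\<dots> \<le> e * B"
        using n order_trans[OF abs_ge_zero w(2)] by (simp add: d'_def mult_right_mono)
      finally show ?thesis .
    qed
    moreover have "\<bar>\<integral>x. d' x * w x \<partial>M\<bar> \<le> l2norm M d' * l2norm M w"
      by (rule l2norm_Cauchy_Schwarz[OF d' w(1)])
    ultimately show "\<bar>\<integral>x. d x * w x \<partial>M\<bar> \<le> e * B + l2norm M d' * l2norm M w" by linarith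
  qed simp
qed

section \<open>Differentiable dependence of the flow on the initial point\<close>

lemma gronwall_forward:
  fixes m :: "real \<Rightarrow> real"
  assumes m: "\<And>s. (m has_real_derivative m' s) (at s)"
    and bound: "\<And>s. 0 \<le> s \<Longrightarrow> s \<le> t \<Longrightarrow> m' s \<le> a * m s + b"
    and "t \<ge> 0" "a \<ge> 0" "b \<ge> 0"
  shows "m t \<le> exp (a * t) * (m 0 + b * t)"
proof -
  define k where "k s = exp (- (a * s)) * m s - b * s" for s
  have k_deriv: "(k has_real_derivative exp (- (a * s)) * (m' s - a * m s) - b) (at s)" for s
    unfolding k_def by (rule derivative_eq_intros refl m)+ (simp add: algebra_simps)
  have "k t \<le> k 0"
  proof (rule DERIV_nonpos_imp_nonincreasing[OF \<open>t \<ge> 0\<close>])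
    fix s assume s: "0 \<le> s" "s \<le> t"
    have "exp (- (a * s)) * (m' s - a * m s) \<le> exp (- (a * s)) * b"
      using bound[OF s] by (intro mult_left_mono) auto
    also have "\<dots> \<le> 1 * b"
      using s \<open>a \<ge> 0\<close> \<open>b \<ge> 0\<close> by (intro mult_right_mono) auto
    finally have "exp (- (a * s)) * (m' s - a * m s) - b \<le> 0" by simp
    then show "\<exists>y. (k has_real_derivative y) (at s) \<and> y \<le> 0" using k_deriv by blast
  qed
  then have "exp (a * t) * (exp (- (a * t)) * m t) \<le> exp (a * t) * (m 0 + b * t)"
    by (intro mult_left_mono) (auto simp: k_def)
  then show ?thesis by (simp add: mult.assoc[symmetric] exp_add[symmetric])
qed

lemma gronwall:
  fixes m :: "real \<Rightarrow> real"
  assumes m: "\<And>s. (m has_real_derivative m' s) (at s)"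
    and bound: "\<And>s. \<bar>s\<bar> \<le> \<bar>t\<bar> \<Longrightarrow> \<bar>m' s\<bar> \<le> a * m s + b"
    and "a \<ge> 0" "b \<ge> 0"
  shows "m t \<le> exp (a * \<bar>t\<bar>) * (m 0 + b * \<bar>t\<bar>)"
proof (cases "t \<ge> 0")
  case True
  have "m' s \<le> a * m s + b" if "0 \<le> s" "s \<le> t" for s using bound[of s] that by simp
  from gronwall_forward[OF m this True assms(3,4)] True show ?thesis by simp
next
  case False
  have "((\<lambda>s. m (- s)) has_real_derivative - m' (- s)) (at s)" for s
    using DERIV_chain2[OF m DERIV_minus[OF DERIV_ident], of s UNIV] by simp
  moreover have "- m' (- s) \<le> a * m (- s) + b" if "0 \<le> s" "s \<le> - t" for s
    using bound[of "- s"] that by simp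
  ultimately have "m (- (- t)) \<le> exp (a * - t) * (m (- 0) + b * - t)"
    using False assms(3,4) by (intro gronwall_forward) auto
  then show ?thesis using False by simp
qed

lemma has_real_derivative_sqrt_inner_add:
  fixes v :: "real \<Rightarrow> 'a::real_inner"
  assumes v: "(v has_vector_derivative v') (at s)" and "\<epsilon> > 0"
  shows "((\<lambda>s. sqrt (v s \<bullet> v s + \<epsilon>)) has_real_derivative v s \<bullet> v' / sqrt (v s \<bullet> v s + \<epsilon>)) (at s)"
proof -
  define q where "q s = v s \<bullet> v s + \<epsilon>" for s
  have "q s > 0" using \<open>\<epsilon> > 0\<close> by (simp add: q_def add_nonneg_pos)
  have "((\<lambda>s. v s \<bullet> v s) has_real_derivative 2 * (v s \<bullet> v')) (at s)"
    using has_derivative_inner[OF v[unfolded has_vector_derivative_def] v[unfolded has_vector_derivative_def]]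
    unfolding has_field_derivative_def
    by (rule has_derivative_eq_rhs) (auto simp: fun_eq_iff algebra_simps inner_commute)
  then have "(q has_real_derivative 2 * (v s \<bullet> v')) (at s)"
    unfolding q_def by (rule DERIV_add[OF _ DERIV_const[of \<epsilon>], simplified])
  with DERIV_real_sqrt[OF \<open>q s > 0\<close>]
  have "((\<lambda>s. sqrt (q s)) has_real_derivative inverse (sqrt (q s)) / 2 * (2 * (v s \<bullet> v'))) (at s)"
    by (rule DERIV_chain2)
  then have "((\<lambda>s. sqrt (q s)) has_real_derivative v s \<bullet> v' / sqrt (q s)) (at s)"
    by (rule DERIV_cong) (simp add: field_simps)
  then show ?thesis unfolding q_def .
qed

text \<open>The norm need not be differentiable at zeros of \<open>v\<close>; hence the regularisation by \<open>\<epsilon>\<close>.\<close>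

lemma gronwall_norm:
  fixes v :: "real \<Rightarrow> 'a::real_inner"
  assumes v: "\<And>s. (v has_vector_derivative v' s) (at s)"
    and bound: "\<And>s. \<bar>s\<bar> \<le> \<bar>t\<bar> \<Longrightarrow> norm (v' s) \<le> a * norm (v s) + b"
    and "a \<ge> 0" "b \<ge> 0"
  shows "norm (v t) \<le> exp (a * \<bar>t\<bar>) * (norm (v 0) + b * \<bar>t\<bar>)"
proof (rule tendsto_lowerbound)
  define g where "g \<epsilon> s = sqrt (v s \<bullet> v s + \<epsilon>)" for \<epsilon> s
  show "((\<lambda>\<epsilon>. exp (a * \<bar>t\<bar>) * (g \<epsilon> 0 + b * \<bar>t\<bar>)) \<longlongrightarrow> exp (a * \<bar>t\<bar>) * (norm (v 0) + b * \<bar>t\<bar>)) (at_right 0)"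
    unfolding g_def norm_eq_sqrt_inner by (rule tendsto_eq_intros refl | simp)+
  show "\<forall>\<^sub>F \<epsilon> in at_right 0. norm (v t) \<le> exp (a * \<bar>t\<bar>) * (g \<epsilon> 0 + b * \<bar>t\<bar>)"
    using eventually_at_right_less
  proof eventually_elim
    case (elim \<epsilon>)
    have g_pos: "g \<epsilon> s > 0" and norm_le_g: "norm (v s) \<le> g \<epsilon> s" for s
      using elim by (simp_all add: g_def add_nonneg_pos norm_eq_sqrt_inner)
    have g_deriv: "(g \<epsilon> has_real_derivative v s \<bullet> v' s / g \<epsilon> s) (at s)" for s
      unfolding g_def by (rule has_real_derivative_sqrt_inner_add[OF v elim])
    have "\<bar>v s \<bullet> v' s / g \<epsilon> s\<bar> \<le> a * g \<epsilon> s + b" if "\<bar>s\<bar> \<le> \<bar>t\<bar>" for s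
    proof -
      have "\<bar>v s \<bullet> v' s\<bar> \<le> g \<epsilon> s * norm (v' s)"
        by (rule order_trans[OF Cauchy_Schwarz_ineq2]) (intro mult_right_mono norm_le_g norm_ge_zero)
      then have "\<bar>v s \<bullet> v' s / g \<epsilon> s\<bar> \<le> norm (v' s)"
        using g_pos[of s] by (simp add: divide_le_eq mult.commute)
      also have "\<dots> \<le> a * norm (v s) + b" by (rule bound[OF that])
      also have "\<dots> \<le> a * g \<epsilon> s + b" using norm_le_g \<open>a \<ge> 0\<close> by (simp add: mult_left_mono)
      finally show ?thesis .
    qed
    from norm_le_g[of t] gronwall[OF g_deriv this assms(3,4)]
    show ?case by (rule order_trans)
  qed
qed simp

definition diff_quotient :: "('a::real_normed_vector \<Rightarrow> 'b::real_normed_vector) \<Rightarrow> 'a \<Rightarrow> real \<Rightarrow> 'a \<Rightarrow> 'b" where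
  "diff_quotient f x h v = (f (x + h *\<^sub>R v) - f x) /\<^sub>R h"

definition Cauchy_quotients_at :: "('a::real_normed_vector \<Rightarrow> 'b::real_normed_vector) \<Rightarrow> 'a \<Rightarrow> bool" where
  "Cauchy_quotients_at f x0 \<longleftrightarrow> (\<forall>e>0. \<exists>\<delta>>0. \<forall>x\<in>ball x0 \<delta>. \<forall>y\<in>ball x0 \<delta>. \<forall>v h k.
      h \<noteq> 0 \<and> k \<noteq> 0 \<and> norm (h *\<^sub>R v) < \<delta> \<and> norm (k *\<^sub>R v) < \<delta> \<longrightarrow>
      norm (diff_quotient f x h v - diff_quotient f y k v) \<le> e * norm v)"

definition strict_derivative_at :: "('a::real_normed_vector \<Rightarrow> 'b::real_normed_vector) \<Rightarrow> ('a \<Rightarrow> 'b) \<Rightarrow> 'a \<Rightarrow> bool" where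
  "strict_derivative_at f T x0 \<longleftrightarrow> (\<forall>e>0. \<exists>\<delta>>0. \<forall>x\<in>ball x0 \<delta>. \<forall>v h.
      h \<noteq> 0 \<and> norm (h *\<^sub>R v) < \<delta> \<longrightarrow> norm (diff_quotient f x h v - T v) \<le> e * norm v)"

lemma pos_mult_lessE:
  fixes e c :: real
  assumes "e > 0"
  obtains e' where "e' > 0" "e' * c < e"
proof
  show "e / (\<bar>c\<bar> + 1) > 0" using assms by simp
  have "e * c < e * (\<bar>c\<bar> + 1)" using assms by (intro mult_strict_left_mono) auto
  then show "e / (\<bar>c\<bar> + 1) * c < e" by (simp add: pos_divide_less_eq add_nonneg_pos)
qed

lemma eventually_norm_scaleR_less:
  fixes v :: "'a::real_normed_vector"
  assumes "\<delta> > 0"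
  shows "\<forall>\<^sub>F h in at 0. h \<noteq> 0 \<and> norm (h *\<^sub>R v) < \<delta>"
proof (rule eventually_conj)
  have "((\<lambda>h. norm (h *\<^sub>R v)) \<longlongrightarrow> 0) (at 0)"
    by (auto intro!: tendsto_eq_intros)
  then show "\<forall>\<^sub>F h in at 0. norm (h *\<^sub>R v) < \<delta>"
    using assms by (rule order_tendstoD)
qed (simp add: eventually_at_filter)

lemma Cauchy_quotients_at_imp_tendsto:
  fixes f :: "'a::real_normed_vector \<Rightarrow> 'b::banach"
  assumes "Cauchy_quotients_at f x0"
  shows "\<exists>l. ((\<lambda>h. diff_quotient f x0 h v) \<longlongrightarrow> l) (at 0)"
proof -
  have "cauchy_filter (filtermap (\<lambda>h. diff_quotient f x0 h v) (at 0))"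
    unfolding cauchy_filter_metric_filtermap
  proof (intro allI impI)
    fix e :: real assume "e > 0"
    obtain e' where e': "e' > 0" "e' * norm v < e"
      by (rule pos_mult_lessE[OF \<open>e > 0\<close>]) (rule that)
    obtain \<delta> where "\<delta> > 0" and "\<And>h k. h \<noteq> 0 \<and> norm (h *\<^sub>R v) < \<delta> \<Longrightarrow> k \<noteq> 0 \<and> norm (k *\<^sub>R v) < \<delta> \<Longrightarrow>
        norm (diff_quotient f x0 h v - diff_quotient f x0 k v) \<le> e' * norm v"
      using assms e'(1) unfolding Cauchy_quotients_at_def by (metis centre_in_ball)
    then have "dist (diff_quotient f x0 h v) (diff_quotient f x0 k v) < e"
      if "h \<noteq> 0 \<and> norm (h *\<^sub>R v) < \<delta>" "k \<noteq> 0 \<and> norm (k *\<^sub>R v) < \<delta>" for h k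
      using that e'(2) unfolding dist_norm by (meson le_less_trans)
    with eventually_norm_scaleR_less[OF \<open>\<delta> > 0\<close>, of v]
    show "\<exists>P. eventually P (at 0) \<and>
        (\<forall>h k. P h \<and> P k \<longrightarrow> dist (diff_quotient f x0 h v) (diff_quotient f x0 k v) < e)"
      by (intro exI[of _ "\<lambda>h. h \<noteq> 0 \<and> norm (h *\<^sub>R v) < \<delta>"]) simp
  qed
  then show ?thesis
    using cauchy_filter_complete_converges[of _ UNIV] complete_UNIV
    by (fastforce simp: filterlim_def filtermap_bot_iff)
qed

lemma Cauchy_quotients_at_imp_strict_derivative:
  fixes f :: "'a::real_normed_vector \<Rightarrow> 'b::banach"
  assumes "Cauchy_quotients_at f x0"
  obtains T where "strict_derivative_at f T x0"
proof -
  obtain T where T: "\<And>v. ((\<lambda>h. diff_quotient f x0 h v) \<longlongrightarrow> T v) (at 0)"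
    using Cauchy_quotients_at_imp_tendsto[OF assms] by metis
  have "\<exists>\<delta>>0. \<forall>x\<in>ball x0 \<delta>. \<forall>v h. h \<noteq> 0 \<and> norm (h *\<^sub>R v) < \<delta> \<longrightarrow>
      norm (diff_quotient f x h v - T v) \<le> e * norm v" if "e > 0" for e
  proof -
    obtain \<delta> where "\<delta> > 0" and \<delta>: "\<And>x h v k. x \<in> ball x0 \<delta> \<Longrightarrow> h \<noteq> 0 \<and> norm (h *\<^sub>R v) < \<delta> \<Longrightarrow>
        k \<noteq> 0 \<and> norm (k *\<^sub>R v) < \<delta> \<Longrightarrow> norm (diff_quotient f x h v - diff_quotient f x0 k v) \<le> e * norm v"
      using assms \<open>e > 0\<close> unfolding Cauchy_quotients_at_def by (metis centre_in_ball)
    have "norm (diff_quotient f x h v - T v) \<le> e * norm v"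
      if "x \<in> ball x0 \<delta>" "h \<noteq> 0 \<and> norm (h *\<^sub>R v) < \<delta>" for x v h
    proof (rule tendsto_upperbound)
      show "((\<lambda>k. norm (diff_quotient f x h v - diff_quotient f x0 k v)) \<longlongrightarrow> norm (diff_quotient f x h v - T v)) (at 0)"
        by (intro tendsto_intros T)
      show "\<forall>\<^sub>F k in at 0. norm (diff_quotient f x h v - diff_quotient f x0 k v) \<le> e * norm v"
        using eventually_norm_scaleR_less[OF \<open>\<delta> > 0\<close>, of v] by (rule eventually_mono) (rule \<delta>[OF that])
    qed simp
    with \<open>\<delta> > 0\<close> show ?thesis by blast
  qed
  then show thesis using that unfolding strict_derivative_at_def by blast
qed

lemma strict_derivative_at_tendsto:
  assumes T: "strict_derivative_at f T x0" and g: "(g \<longlongrightarrow> x0) F" and k: "filterlim k (at 0) F"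
  shows "((\<lambda>i. diff_quotient f (g i) (k i) v) \<longlongrightarrow> T v) F"
proof (rule tendstoI)
  fix e :: real assume "e > 0"
  obtain e' where e': "e' > 0" "e' * norm v < e"
    by (rule pos_mult_lessE[OF \<open>e > 0\<close>]) (rule that)
  obtain \<delta> where "\<delta> > 0" and \<delta>: "\<And>x h. x \<in> ball x0 \<delta> \<Longrightarrow> h \<noteq> 0 \<and> norm (h *\<^sub>R v) < \<delta> \<Longrightarrow>
      norm (diff_quotient f x h v - T v) \<le> e' * norm v"
    using T e'(1) unfolding strict_derivative_at_def by metis
  have "\<forall>\<^sub>F i in F. g i \<in> ball x0 \<delta>"
    using tendstoD[OF g \<open>\<delta> > 0\<close>] by (simp add: dist_commute)
  moreover have "\<forall>\<^sub>F i in F. k i \<noteq> 0 \<and> norm (k i *\<^sub>R v) < \<delta>"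
    by (rule eventually_compose_filterlim[OF eventually_norm_scaleR_less[OF \<open>\<delta> > 0\<close>] k])
  ultimately show "\<forall>\<^sub>F i in F. dist (diff_quotient f (g i) (k i) v) (T v) < e"
    by eventually_elim (use \<delta> e'(2) in \<open>fastforce simp: dist_norm\<close>)
qed

lemma strict_derivative_at_linear:
  assumes T: "strict_derivative_at f T x0"
  shows "linear T"
proof (rule linearI)
  note lim = strict_derivative_at_tendsto[OF T]
  note unique = tendsto_unique[OF at_neq_bot lim[OF tendsto_const filterlim_ident]]
  show "T (v + w) = T v + T w" for v w
  proof (rule unique)
    have "((\<lambda>h. x0 + h *\<^sub>R w) \<longlongrightarrow> x0) (at 0)"
      by (auto intro!: tendsto_eq_intros)
    then have "((\<lambda>h. diff_quotient f (x0 + h *\<^sub>R w) h v + diff_quotient f x0 h w) \<longlongrightarrow> T v + T w) (at 0)"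
      by (intro tendsto_add lim tendsto_const filterlim_ident)
    moreover have "diff_quotient f (x0 + h *\<^sub>R w) h v + diff_quotient f x0 h w = diff_quotient f x0 h (v + w)" for h
      by (simp add: diff_quotient_def algebra_simps)
    ultimately show "((\<lambda>h. diff_quotient f x0 h (v + w)) \<longlongrightarrow> T v + T w) (at 0)" by (simp only:)
  qed
  show "T (c *\<^sub>R v) = c *\<^sub>R T v" for c v
  proof (rule unique)
    show "((\<lambda>h. diff_quotient f x0 h (c *\<^sub>R v)) \<longlongrightarrow> c *\<^sub>R T v) (at 0)"
    proof (cases "c = 0")
      case False
      then have "filterlim (\<lambda>h. c * h) (at 0) (at 0)"
        by (auto simp: filterlim_at eventually_at_filter intro!: tendsto_eq_intros)
      then have "((\<lambda>h. c *\<^sub>R diff_quotient f x0 (c * h) v) \<longlongrightarrow> c *\<^sub>R T v) (at 0)"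
        by (intro tendsto_scaleR lim tendsto_const)
      moreover have "c *\<^sub>R diff_quotient f x0 (c * h) v = diff_quotient f x0 h (c *\<^sub>R v)" for h
        using False by (simp add: diff_quotient_def mult.commute)
      ultimately show ?thesis by (simp only:)
    qed (simp add: diff_quotient_def)
  qed
qed

lemma strict_derivative_at_has_derivative:
  fixes f :: "'a::euclidean_space \<Rightarrow> 'b::real_normed_vector"
  assumes T: "strict_derivative_at f T x0"
  shows "(f has_derivative T) (at x0)"
  unfolding has_derivative_at_alt
proof (intro conjI allI impI)
  show "bounded_linear T" using strict_derivative_at_linear[OF T] by (rule linear_conv_bounded_linear[THEN iffD1])
  fix e :: real assume "e > 0"
  then obtain \<delta> where "\<delta> > 0" and \<delta>: "\<And>v h. h \<noteq> 0 \<and> norm (h *\<^sub>R v) < \<delta> \<Longrightarrow>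
      norm (diff_quotient f x0 h v - T v) \<le> e * norm v"
    using T unfolding strict_derivative_at_def by (metis centre_in_ball)
  have "norm (f y - f x0 - T (y - x0)) \<le> e * norm (y - x0)" if "norm (y - x0) < \<delta>" for y
    using \<delta>[of 1 "y - x0"] that by (simp add: diff_quotient_def)
  with \<open>\<delta> > 0\<close> show "\<exists>d>0. \<forall>y. norm (y - x0) < d \<longrightarrow> norm (f y - f x0 - T (y - x0)) \<le> e * norm (y - x0)"
    by blast
qed

lemma strict_derivative_at_continuous:
  assumes T: "\<And>x. strict_derivative_at f (T x) x"
  shows "continuous_on UNIV (\<lambda>x. T x v)"
  unfolding continuous_on_iff
proof (intro ballI allI impI)
  fix x0 and e :: real assume "e > 0"
  obtain e' where e': "e' > 0" "e' * norm v < e"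
    by (rule pos_mult_lessE[OF \<open>e > 0\<close>]) (rule that)
  obtain \<delta> where "\<delta> > 0" and \<delta>: "\<And>x h. x \<in> ball x0 \<delta> \<Longrightarrow> h \<noteq> 0 \<and> norm (h *\<^sub>R v) < \<delta> \<Longrightarrow>
      norm (diff_quotient f x h v - T x0 v) \<le> e' * norm v"
    using T e'(1) unfolding strict_derivative_at_def by metis
  have "dist (T x v) (T x0 v) < e" if "dist x x0 < \<delta>" for x
  proof -
    have "norm (T x v - T x0 v) \<le> e' * norm v"
    proof (rule tendsto_upperbound)
      show "((\<lambda>h. norm (diff_quotient f x h v - T x0 v)) \<longlongrightarrow> norm (T x v - T x0 v)) (at 0)"
        by (intro tendsto_intros strict_derivative_at_tendsto[OF T] filterlim_ident)
      show "\<forall>\<^sub>F h in at 0. norm (diff_quotient f x h v - T x0 v) \<le> e' * norm v"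
        using eventually_norm_scaleR_less[OF \<open>\<delta> > 0\<close>, of v]
        by (rule eventually_mono) (use \<delta> that in \<open>auto simp: dist_commute\<close>)
    qed simp
    then show ?thesis using e'(2) by (simp add: dist_norm)
  qed
  with \<open>\<delta> > 0\<close> show "\<exists>\<delta>>0. \<forall>x\<in>UNIV. dist x x0 < \<delta> \<longrightarrow> dist (T x v) (T x0 v) < e" by blast
qed

locale c1_flow =
  fixes F :: "'a::euclidean_space \<Rightarrow> 'a" and F' :: "'a \<Rightarrow> 'a \<Rightarrow>\<^sub>L 'a"
    and L :: real and \<phi> :: "real \<Rightarrow> 'a \<Rightarrow> 'a"
  assumes F'_cont: "continuous_on UNIV F'"
    and F'_bound: "\<And>x. norm (F' x) \<le> L"
    and F_deriv: "\<And>x. (F has_derivative blinfun_apply (F' x)) (at x)"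
    and flow0 [simp]: "\<And>x. \<phi> 0 x = x"
    and flow_add: "\<And>s t. \<phi> (t + s) = \<phi> t \<circ> \<phi> s"
    and flow_deriv: "\<And>t x. ((\<lambda>t. \<phi> t x) has_vector_derivative F (\<phi> t x)) (at t)"
begin

lemma L_nonneg: "L \<ge> 0"
  using F'_bound[of 0] norm_ge_zero[of "F' 0"] by linarith

lemma F_lipschitz: "norm (F x - F y) \<le> L * norm (x - y)"
  using differentiable_bound[of UNIV F "\<lambda>x. blinfun_apply (F' x)" L] F_deriv F'_bound
  by (auto simp: norm_blinfun.rep_eq)

lemma F_continuous: "continuous_on S F"
  by (meson F_deriv continuous_at_imp_continuous_on has_derivative_continuous)

lemma flow_flow: "\<phi> t (\<phi> s x) = \<phi> (t + s) x"
  by (simp add: flow_add)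

lemma flow_inverse [simp]: "\<phi> t (\<phi> (-t) x) = x" "\<phi> (-t) (\<phi> t x) = x"
  by (simp_all add: flow_flow)

lemma flow_lipschitz: "norm (\<phi> t x - \<phi> t y) \<le> exp (L * \<bar>t\<bar>) * norm (x - y)"
  using gronwall_norm[OF has_vector_derivative_diff[OF flow_deriv flow_deriv], of t x y L 0]
  by (simp add: F_lipschitz L_nonneg)

lemma flow_lipschitz_le:
  assumes "\<bar>t\<bar> \<le> T"
  shows "norm (\<phi> t x - \<phi> t y) \<le> exp (L * T) * norm (x - y)"
  by (rule order_trans[OF flow_lipschitz]) (use assms L_nonneg in \<open>simp add: mult_left_mono mult_right_mono\<close>)

lemma flow_lipschitz_on: "(exp (L * \<bar>t\<bar>))-lipschitz_on S (\<phi> t)"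
  by (rule lipschitz_onI) (simp_all add: dist_norm flow_lipschitz)

lemma flow_continuous: "continuous_on S (\<phi> t)"
  by (rule lipschitz_on_continuous_on[OF flow_lipschitz_on])

lemma flow_time_continuous: "continuous_on S (\<lambda>t. \<phi> t x)"
  by (intro continuous_at_imp_continuous_on ballI has_vector_derivative_continuous[OF flow_deriv])

lemma orbit_boundedE:
  obtains B where "\<And>s. \<bar>s\<bar> \<le> T \<Longrightarrow> norm (\<phi> s x) \<le> B"
proof -
  have "bounded ((\<lambda>s. \<phi> s x) ` {-T..T})"
    by (intro compact_imp_bounded compact_continuous_image flow_time_continuous) auto
  then show thesis using that by (force simp: bounded_iff abs_le_iff)
qed

lemma flow_preimage_boundedE:
  obtains R' where "\<And>t x. \<bar>t\<bar> \<le> T \<Longrightarrow> norm (\<phi> t x) \<le> R \<Longrightarrow> norm x \<le> R'"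
proof -
  obtain B where B: "\<And>s. \<bar>s\<bar> \<le> T \<Longrightarrow> norm (\<phi> s 0) \<le> B"
    by (rule orbit_boundedE[of T 0]) (rule that)
  have "norm x \<le> exp (L * T) * R + B" if "\<bar>t\<bar> \<le> T" "norm (\<phi> t x) \<le> R" for t x
  proof -
    have "norm (x - \<phi> (-t) 0) \<le> exp (L * T) * norm (\<phi> t x)"
      using flow_lipschitz_le[of "-t" T "\<phi> t x" 0] that(1) by simp
    also have "\<dots> \<le> exp (L * T) * R" using that(2) by (intro mult_left_mono) auto
    finally show ?thesis
      using norm_triangle_sub[of x "\<phi> (-t) 0"] B[of "-t"] that(1) by simp
  qed
  then show thesis by (rule that)
qed

lemma linearization_along_orbit:
  assumes "e > 0"
  obtains \<delta> where "\<delta> > 0" "\<And>s p q. \<bar>s\<bar> \<le> T \<Longrightarrow> p \<in> ball (\<phi> s x0) \<delta> \<Longrightarrow> q \<in> ball (\<phi> s x0) \<delta> \<Longrightarrow>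
    norm (F p - F q - F' (\<phi> s x0) (p - q)) \<le> e * norm (p - q)"
proof -
  obtain R where R: "\<And>s. \<bar>s\<bar> \<le> T \<Longrightarrow> norm (\<phi> s x0) \<le> R"
    by (rule orbit_boundedE[of T x0]) (rule that)
  have "uniformly_continuous_on (cball 0 (R + 1)) F'"
    by (intro compact_uniformly_continuous continuous_on_subset[OF F'_cont]) auto
  then obtain d where d: "d > 0" and F'_close: "\<And>z w. norm z \<le> R + 1 \<Longrightarrow> norm w \<le> R + 1 \<Longrightarrow>
      dist z w < d \<Longrightarrow> dist (F' z) (F' w) < e"
    using assms unfolding uniformly_continuous_on_def by (metis mem_cball_0)
  show thesis
  proof
    show "min d 1 > 0" using d by simp
    fix s p q assume s: "\<bar>s\<bar> \<le> T" and p: "p \<in> ball (\<phi> s x0) (min d 1)" and q: "q \<in> ball (\<phi> s x0) (min d 1)"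
    let ?w = "\<phi> s x0"
    have "norm ((F p - F' ?w p) - (F q - F' ?w q)) \<le> e * norm (p - q)"
    proof (rule differentiable_bound[OF convex_ball[of ?w "min d 1"]])
      fix z assume z: "z \<in> ball ?w (min d 1)"
      have "((\<lambda>z. F z - F' ?w z) has_derivative (\<lambda>h. F' z h - F' ?w h)) (at z)"
        by (intro has_derivative_diff F_deriv blinfun.bounded_linear_right[THEN bounded_linear_imp_has_derivative])
      then show "((\<lambda>z. F z - F' ?w z) has_derivative blinfun_apply (F' z - F' ?w)) (at z within ball ?w (min d 1))"
        by (simp add: blinfun.diff_left[abs_def] has_derivative_at_withinI fun_diff_def)
      have "norm z \<le> R + 1" using z R[OF s] norm_triangle_sub[of z ?w]
        by (simp add: dist_norm norm_minus_commute)
      then have "dist (F' z) (F' ?w) < e"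
        using z R[OF s] by (intro F'_close) (auto simp: dist_commute)
      then show "onorm (blinfun_apply (F' z - F' ?w)) \<le> e"
        by (simp add: dist_norm norm_blinfun.rep_eq)
    qed (use p q in auto)
    then show "norm (F p - F q - F' ?w (p - q)) \<le> e * norm (p - q)"
      by (simp add: blinfun.diff_right algebra_simps)
  qed
qed

lemma diff_quotient_linearization_along_orbit:
  assumes "e > 0"
  obtains \<delta> where "\<delta> > 0" "\<And>s x h v. \<bar>s\<bar> \<le> T \<Longrightarrow> x \<in> ball x0 \<delta> \<Longrightarrow> h \<noteq> 0 \<and> norm (h *\<^sub>R v) < \<delta> \<Longrightarrow>
    norm (diff_quotient (\<lambda>x. F (\<phi> s x)) x h v - F' (\<phi> s x0) (diff_quotient (\<phi> s) x h v)) \<le> e * norm v"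
proof -
  define K where "K = exp (L * T)"
  have "K > 0" by (simp add: K_def)
  then have "e / K > 0" using assms by simp
  then obtain \<delta> where "\<delta> > 0" and \<delta>: "\<And>s p q. \<bar>s\<bar> \<le> T \<Longrightarrow> p \<in> ball (\<phi> s x0) \<delta> \<Longrightarrow> q \<in> ball (\<phi> s x0) \<delta> \<Longrightarrow>
      norm (F p - F q - F' (\<phi> s x0) (p - q)) \<le> e / K * norm (p - q)"
    by (rule linearization_along_orbit[of "e / K" T x0]) (rule that)
  have near: "\<phi> s z \<in> ball (\<phi> s x0) \<delta>" if "\<bar>s\<bar> \<le> T" "norm (z - x0) < \<delta> / K" for s z
  proof -
    have "norm (\<phi> s z - \<phi> s x0) \<le> K * norm (z - x0)" unfolding K_def by (rule flow_lipschitz_le[OF that(1)])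
    also have "\<dots> < \<delta>" using that(2) \<open>K > 0\<close> by (simp add: pos_less_divide_eq mult.commute)
    finally show ?thesis by (simp add: dist_norm norm_minus_commute)
  qed
  show thesis
  proof (rule that)
    show "\<delta> / (2 * K) > 0" using \<open>\<delta> > 0\<close> \<open>K > 0\<close> by simp
    fix s x h and v :: 'a
    assume s: "\<bar>s\<bar> \<le> T" and x: "x \<in> ball x0 (\<delta> / (2 * K))" and h: "h \<noteq> 0 \<and> norm (h *\<^sub>R v) < \<delta> / (2 * K)"
    let ?p = "\<phi> s (x + h *\<^sub>R v)" and ?q = "\<phi> s x"
    have half: "norm (x - x0) < \<delta> / K / 2" "norm (h *\<^sub>R v) < \<delta> / K / 2"
      using x h by (simp_all add: dist_norm norm_minus_commute mult.commute)
    moreover have "norm (x + h *\<^sub>R v - x0) \<le> norm (x - x0) + norm (h *\<^sub>R v)"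
      using norm_triangle_ineq[of "x - x0" "h *\<^sub>R v"] by (simp add: algebra_simps)
    ultimately have "norm (x + h *\<^sub>R v - x0) < \<delta> / K" "norm (x - x0) < \<delta> / K"
      using norm_ge_zero[of "h *\<^sub>R v"] norm_ge_zero[of "x - x0"] by linarith+
    then have "norm (F ?p - F ?q - F' (\<phi> s x0) (?p - ?q)) \<le> e / K * norm (?p - ?q)"
      by (intro \<delta> near s)
    also have "\<dots> \<le> e / K * (K * norm (h *\<^sub>R v))"
      using flow_lipschitz_le[OF s, of "x + h *\<^sub>R v" x] \<open>e / K > 0\<close> by (intro mult_left_mono) (auto simp: K_def)
    also have "\<dots> = \<bar>h\<bar> * (e * norm v)" using \<open>K > 0\<close> by simp
    finally have "norm (F ?p - F ?q - F' (\<phi> s x0) (?p - ?q)) / \<bar>h\<bar> \<le> e * norm v"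
      using h by (simp add: pos_divide_le_eq mult.commute)
    moreover have "diff_quotient (\<lambda>x. F (\<phi> s x)) x h v - F' (\<phi> s x0) (diff_quotient (\<phi> s) x h v)
        = (F ?p - F ?q - F' (\<phi> s x0) (?p - ?q)) /\<^sub>R h"
      by (simp add: diff_quotient_def blinfun.scaleR_right blinfun.diff_right scaleR_diff_right)
    ultimately show "norm (diff_quotient (\<lambda>x. F (\<phi> s x)) x h v - F' (\<phi> s x0) (diff_quotient (\<phi> s) x h v)) \<le> e * norm v"
      by (simp add: divide_inverse mult.commute)
  qed
qed

text \<open>Two difference quotients along nearby orbits solve the variational equation up to a small error.
  Gronwall's inequality therefore makes them Cauchy, and no solution of that equation is needed.\<close>

lemma diff_quotient_flow_diff_le:
  assumes "h \<noteq> 0" "k \<noteq> 0" and "b \<ge> 0"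
    and x: "\<And>s. \<bar>s\<bar> \<le> \<bar>t\<bar> \<Longrightarrow>
      norm (diff_quotient (\<lambda>x. F (\<phi> s x)) x h v - F' (\<phi> s z) (diff_quotient (\<phi> s) x h v)) \<le> b"
    and y: "\<And>s. \<bar>s\<bar> \<le> \<bar>t\<bar> \<Longrightarrow>
      norm (diff_quotient (\<lambda>x. F (\<phi> s x)) y k v - F' (\<phi> s z) (diff_quotient (\<phi> s) y k v)) \<le> b"
  shows "norm (diff_quotient (\<phi> t) x h v - diff_quotient (\<phi> t) y k v) \<le> exp (L * \<bar>t\<bar>) * (2 * b * \<bar>t\<bar>)"
proof -
  define D where "D s = diff_quotient (\<phi> s) x h v - diff_quotient (\<phi> s) y k v" for s
  define D' where "D' s = diff_quotient (\<lambda>x. F (\<phi> s x)) x h v - diff_quotient (\<lambda>x. F (\<phi> s x)) y k v" for s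
  have D_deriv: "(D has_vector_derivative D' s) (at s)" for s
    unfolding D_def D'_def diff_quotient_def
    by (intro has_vector_derivative_diff flow_deriv
        has_vector_derivative_scaleR[OF DERIV_const, where 'a = 'a, simplified])
  have D'_bound: "norm (D' s) \<le> L * norm (D s) + 2 * b" if s: "\<bar>s\<bar> \<le> \<bar>t\<bar>" for s
  proof -
    have "D' s = F' (\<phi> s z) (D s)
      + (diff_quotient (\<lambda>x. F (\<phi> s x)) x h v - F' (\<phi> s z) (diff_quotient (\<phi> s) x h v))
      - (diff_quotient (\<lambda>x. F (\<phi> s x)) y k v - F' (\<phi> s z) (diff_quotient (\<phi> s) y k v))"
      by (simp add: D_def D'_def blinfun.diff_right)
    also have "norm \<dots> \<le> norm (F' (\<phi> s z) (D s)) + b + b"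
      by (intro order_trans[OF norm_triangle_ineq4] order_trans[OF norm_triangle_ineq] add_mono
          x[OF s] y[OF s] order_refl)
    also have "norm (F' (\<phi> s z) (D s)) \<le> L * norm (D s)"
      by (rule order_trans[OF norm_blinfun]) (intro mult_right_mono F'_bound norm_ge_zero)
    finally show ?thesis by simp
  qed
  have "D 0 = 0" using assms(1,2) by (simp add: D_def diff_quotient_def)
  then have "norm (D t) \<le> exp (L * \<bar>t\<bar>) * (2 * b * \<bar>t\<bar>)"
    using gronwall_norm[OF D_deriv D'_bound L_nonneg] \<open>b \<ge> 0\<close> by simp
  then show ?thesis by (simp add: D_def)
qed

lemma flow_Cauchy_quotients: "Cauchy_quotients_at (\<phi> t) x0"
  unfolding Cauchy_quotients_at_def
proof (intro allI impI)
  fix e :: real assume "e > 0"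
  obtain e' where "e' > 0" and e': "e' * (2 * exp (L * \<bar>t\<bar>) * \<bar>t\<bar>) < e"
    by (rule pos_mult_lessE[OF \<open>e > 0\<close>]) (rule that)
  obtain \<delta> where "\<delta> > 0" and \<delta>: "\<And>s x h v. \<bar>s\<bar> \<le> \<bar>t\<bar> \<Longrightarrow> x \<in> ball x0 \<delta> \<Longrightarrow> h \<noteq> 0 \<and> norm (h *\<^sub>R v) < \<delta> \<Longrightarrow>
      norm (diff_quotient (\<lambda>x. F (\<phi> s x)) x h v - F' (\<phi> s x0) (diff_quotient (\<phi> s) x h v)) \<le> e' * norm v"
    by (rule diff_quotient_linearization_along_orbit[OF \<open>e' > 0\<close>, of "\<bar>t\<bar>" x0]) (rule that)
  have "norm (diff_quotient (\<phi> t) x h v - diff_quotient (\<phi> t) y k v) \<le> e * norm v"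
    if x: "x \<in> ball x0 \<delta>" and y: "y \<in> ball x0 \<delta>" and h: "h \<noteq> 0 \<and> norm (h *\<^sub>R v) < \<delta>"
      and k: "k \<noteq> 0 \<and> norm (k *\<^sub>R v) < \<delta>" for x y v h k
  proof -
    have "norm (diff_quotient (\<phi> t) x h v - diff_quotient (\<phi> t) y k v) \<le> exp (L * \<bar>t\<bar>) * (2 * (e' * norm v) * \<bar>t\<bar>)"
      using h k \<open>e' > 0\<close> by (intro diff_quotient_flow_diff_le[where z = x0] \<delta> x y) auto
    also have "\<dots> = e' * (2 * exp (L * \<bar>t\<bar>) * \<bar>t\<bar>) * norm v" by simp
    also have "\<dots> \<le> e * norm v" by (intro mult_right_mono less_imp_le[OF e']) simp
    finally show ?thesis .
  qed
  with \<open>\<delta> > 0\<close> show "\<exists>\<delta>>0. \<forall>x\<in>ball x0 \<delta>. \<forall>y\<in>ball x0 \<delta>. \<forall>v h k.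
      h \<noteq> 0 \<and> k \<noteq> 0 \<and> norm (h *\<^sub>R v) < \<delta> \<and> norm (k *\<^sub>R v) < \<delta> \<longrightarrow>
      norm (diff_quotient (\<phi> t) x h v - diff_quotient (\<phi> t) y k v) \<le> e * norm v"
    by blast
qed

lemma flow_C1:
  obtains T where "\<And>x. (\<phi> t has_derivative T x) (at x)" "\<And>v. continuous_on UNIV (\<lambda>x. T x v)"
proof -
  have "\<exists>T. strict_derivative_at (\<phi> t) T x" for x
    using Cauchy_quotients_at_imp_strict_derivative[OF flow_Cauchy_quotients] by metis
  then obtain T where "\<And>x. strict_derivative_at (\<phi> t) (T x) x" by metis
  then show thesis
    using that strict_derivative_at_has_derivative strict_derivative_at_continuous by blast
qed

lemma flow_derivative_F:
  assumes T: "(\<phi> t has_derivative T) (at x)"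
  shows "T (F x) = F (\<phi> t x)"
proof (rule vector_derivative_unique_at)
  have orbit: "((\<lambda>s. \<phi> s y) has_vector_derivative F y) (at 0)" for y
    using flow_deriv[of y 0] by simp
  have "((\<lambda>s. \<phi> t (\<phi> s x)) has_derivative (\<lambda>h. T (h *\<^sub>R F x))) (at 0)"
    using has_derivative_compose[OF orbit[of x, unfolded has_vector_derivative_def], of "\<phi> t" T] T by simp
  then show "((\<lambda>s. \<phi> t (\<phi> s x)) has_vector_derivative T (F x)) (at 0)"
    by (simp add: has_vector_derivative_def linear_cmul[OF has_derivative_linear[OF T]])
  show "((\<lambda>s. \<phi> t (\<phi> s x)) has_vector_derivative F (\<phi> t x)) (at 0)"
    using orbit[of "\<phi> t x"] by (simp add: flow_flow add.commute)
qed

end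

section \<open>Lipschitz images of Lebesgue measurable sets\<close>

lemma emeasure_UN_le_mult_disjoint:
  assumes "countable I" and A: "\<And>i. i \<in> I \<Longrightarrow> A i \<in> sets M" "disjoint_family_on A I"
    and B: "\<And>i. i \<in> I \<Longrightarrow> B i \<in> sets N" and le: "\<And>i. i \<in> I \<Longrightarrow> emeasure N (B i) \<le> c * emeasure M (A i)"
  shows "emeasure N (\<Union>i\<in>I. B i) \<le> c * emeasure M (\<Union>i\<in>I. A i)"
proof (cases "I = {}")
  case False
  define J where "J n = from_nat_into I ` {..n}" for n
  have J: "finite (J n)" "J n \<subseteq> I" for n
    using from_nat_into[OF False] by (auto simp: J_def)
  have "emeasure N (\<Union>i\<in>J n. B i) \<le> c * emeasure M (\<Union>i\<in>I. A i)" for n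
  proof -
    have "emeasure N (\<Union>i\<in>J n. B i) \<le> (\<Sum>i\<in>J n. emeasure N (B i))"
      using J B by (intro emeasure_subadditive_finite) auto
    also have "\<dots> \<le> (\<Sum>i\<in>J n. c * emeasure M (A i))"
      using J by (intro sum_mono le) auto
    also have "\<dots> = c * emeasure M (\<Union>i\<in>J n. A i)"
      using J A disjoint_family_on_mono[OF J(2) A(2)]
      by (subst sum_emeasure[symmetric]) (auto simp: sum_distrib_left)
    also have "\<dots> \<le> c * emeasure M (\<Union>i\<in>I. A i)"
      using J A \<open>countable I\<close> by (intro mult_left_mono emeasure_mono UN_mono sets.countable_UN') auto
    finally show ?thesis .
  qed
  moreover have "(\<lambda>n. emeasure N (\<Union>i\<in>J n. B i)) \<longlonglongrightarrow> emeasure N (\<Union>n. \<Union>i\<in>J n. B i)"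
    using J B by (intro Lim_emeasure_incseq) (fastforce simp: incseq_def J_def)+
  moreover have "(\<Union>n. \<Union>i\<in>J n. B i) = (\<Union>i\<in>I. B i)"
    using from_nat_into_surj[OF \<open>countable I\<close>] J(2) unfolding J_def by fastforce
  ultimately show ?thesis by (auto intro: LIMSEQ_le_const2)
qed simp

lemma lipschitz_negligible_image:
  fixes f :: "'a::euclidean_space \<Rightarrow> 'a"
  assumes "K-lipschitz_on UNIV f" "negligible S"
  shows "negligible (f ` S)"
  using assms by (intro negligible_locally_Lipschitz_image)
    (auto simp: dist_norm[symmetric] intro!: exI[of _ UNIV] exI[of _ K] lipschitz_onD)

lemma lipschitz_image_sets_lebesgue:
  fixes f :: "'a::euclidean_space \<Rightarrow> 'a"
  assumes "K-lipschitz_on UNIV f" "S \<in> sets lebesgue"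
  shows "f ` S \<in> sets lebesgue"
  using assms by (intro sets_lebesgue_continuous_image[of S UNIV])
    (auto intro: lipschitz_on_continuous_on lipschitz_negligible_image)

lemma emeasure_lipschitz_image_ball_le:
  fixes f :: "'a::euclidean_space \<Rightarrow> 'a"
  assumes f: "K-lipschitz_on UNIV f" and "r \<ge> 0"
  shows "emeasure lebesgue (f ` ball x r) \<le> ennreal (K ^ DIM('a)) * emeasure lebesgue (ball x r)"
proof -
  have "K \<ge> 0" by (rule lipschitz_on_nonneg[OF f])
  have "f ` ball x r \<subseteq> cball (f x) (K * r)"
  proof clarsimp
    fix y assume "dist x y < r"
    then have "K * dist x y \<le> K * r" using \<open>K \<ge> 0\<close> by (intro mult_left_mono) auto
    then show "dist (f x) (f y) \<le> K * r" using lipschitz_onD[OF f, of x y] by simp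
  qed
  then have "emeasure lebesgue (f ` ball x r) \<le> emeasure lebesgue (cball (f x) (K * r))"
    by (intro emeasure_mono) auto
  also have "\<dots> = ennreal (K ^ DIM('a)) * emeasure lebesgue (ball x r)"
    using \<open>K \<ge> 0\<close> \<open>r \<ge> 0\<close>
    by (simp add: emeasure_cball emeasure_ball ennreal_mult[symmetric] power_mult_distrib unit_ball_vol_nonneg mult_ac)
  finally show ?thesis .
qed

lemma emeasure_lipschitz_image_open_le:
  fixes f :: "'a::euclidean_space \<Rightarrow> 'a"
  assumes f: "K-lipschitz_on UNIV f" and "open U"
  shows "emeasure lebesgue (f ` U) \<le> ennreal (K ^ DIM('a)) * emeasure lebesgue U"
proof -
  define I where "I = {i. 0 < snd i \<and> ball (fst i) (snd i) \<subseteq> U}"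
  define A where "A i = ball (fst i) (snd i)" for i :: "'a \<times> real"
  have fine_cover: "\<exists>i. i \<in> I \<and> x \<in> ball (fst i) (snd i) \<and> snd i < d" if "x \<in> U" "0 < d" for x d
  proof -
    obtain e where "e > 0" "ball x e \<subseteq> U" using \<open>open U\<close> \<open>x \<in> U\<close> by (rule openE)
    then have "(x, min e (d / 2)) \<in> I" using \<open>0 < d\<close> by (auto simp: I_def)
    then show ?thesis using \<open>0 < d\<close> \<open>e > 0\<close> by (intro exI[of _ "(x, min e (d / 2))"]) auto
  qed
  obtain C where C: "countable C" "C \<subseteq> I" "pairwise (\<lambda>i j. disjnt (A i) (A j)) C" "negligible (U - (\<Union>i\<in>C. A i))"
    by (rule Vitali_covering_theorem_balls[OF fine_cover]) (assumption, assumption, rule that, simp_all add: A_def)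
  have disjoint: "disjoint_family_on A C"
    using C(3) by (auto simp: disjoint_family_on_def pairwise_def disjnt_def)
  have A: "A i \<in> sets lebesgue" "A i \<subseteq> U" if "i \<in> C" for i
    using subsetD[OF C(2) that] by (simp_all add: A_def I_def)
  have image: "f ` A i \<in> sets lebesgue" if "i \<in> C" for i
    by (rule lipschitz_image_sets_lebesgue[OF f A(1)[OF that]])
  define N where "N = f ` (U - (\<Union>i\<in>C. A i))"
  have N: "N \<in> null_sets lebesgue"
    using lipschitz_negligible_image[OF f C(4)] by (simp add: N_def negligible_iff_null_sets)
  have union: "(\<Union>i\<in>C. f ` A i) \<in> sets lebesgue"
    by (intro sets.countable_UN' C(1)) (use image in blast)
  have "f ` U \<subseteq> N \<union> (\<Union>i\<in>C. f ` A i)" by (auto simp: N_def)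
  then have "emeasure lebesgue (f ` U) \<le> emeasure lebesgue (N \<union> (\<Union>i\<in>C. f ` A i))"
    by (intro emeasure_mono sets.Un null_setsD2[OF N] union)
  also have "\<dots> = emeasure lebesgue (\<Union>i\<in>C. f ` A i)"
    unfolding Un_commute[of N] by (rule emeasure_Un_null_set[OF union N])
  also have "\<dots> \<le> ennreal (K ^ DIM('a)) * emeasure lebesgue (\<Union>i\<in>C. A i)"
  proof (rule emeasure_UN_le_mult_disjoint[OF C(1) A(1) disjoint image])
    show "emeasure lebesgue (f ` A i) \<le> ennreal (K ^ DIM('a)) * emeasure lebesgue (A i)" if "i \<in> C" for i
      using emeasure_lipschitz_image_ball_le[OF f, of "snd i" "fst i"] subsetD[OF C(2) that]
      by (simp add: A_def I_def)
  qed
  also have "\<dots> \<le> ennreal (K ^ DIM('a)) * emeasure lebesgue U"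
    using A(2) \<open>open U\<close> by (intro mult_left_mono emeasure_mono) auto
  finally show ?thesis .
qed

lemma emeasure_lipschitz_image_le:
  fixes f :: "'a::euclidean_space \<Rightarrow> 'a"
  assumes f: "K-lipschitz_on UNIV f" and S: "S \<in> sets lebesgue"
  shows "emeasure lebesgue (f ` S) \<le> ennreal (K ^ DIM('a)) * emeasure lebesgue S"
proof (rule ennreal_le_epsilon)
  fix e :: real assume "0 < e"
  have "K \<ge> 0" by (rule lipschitz_on_nonneg[OF f])
  obtain e' where "e' > 0" and e': "e' * K ^ DIM('a) < e"
    by (rule pos_mult_lessE[OF \<open>0 < e\<close>]) (rule that)
  obtain U where U: "open U" "S \<subseteq> U" "U - S \<in> lmeasurable" "emeasure lebesgue (U - S) < ennreal e'"
    by (rule sets_lebesgue_outer_open[OF S \<open>e' > 0\<close>])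
  have "emeasure lebesgue (f ` S) \<le> emeasure lebesgue (f ` U)"
    using U(1,2) by (intro emeasure_mono image_mono lipschitz_image_sets_lebesgue[OF f]) auto
  also have "\<dots> \<le> ennreal (K ^ DIM('a)) * emeasure lebesgue U"
    by (rule emeasure_lipschitz_image_open_le[OF f U(1)])
  also have "emeasure lebesgue U = emeasure lebesgue S + emeasure lebesgue (U - S)"
    using U(2,3) S by (subst plus_emeasure) (auto simp: Un_absorb1 fmeasurableD)
  also have "ennreal (K ^ DIM('a)) * \<dots> \<le> ennreal (K ^ DIM('a)) * (emeasure lebesgue S + ennreal e')"
    using U(4) by (intro mult_left_mono add_left_mono) auto
  also have "\<dots> \<le> ennreal (K ^ DIM('a)) * emeasure lebesgue S + ennreal e"
    using e' \<open>K \<ge> 0\<close> \<open>e' > 0\<close>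
    by (simp add: distrib_left ennreal_mult[symmetric] ennreal_leI add_left_mono mult.commute)
  finally show "emeasure lebesgue (f ` S) \<le> ennreal (K ^ DIM('a)) * emeasure lebesgue S + ennreal e" .
qed

context c1_flow
begin

lemma flow_vimage_eq_image: "\<phi> t -` A = \<phi> (-t) ` A"
  using flow_inverse by (force simp: image_iff)

lemma flow_vimage_sets: "A \<in> sets lebesgue \<Longrightarrow> \<phi> t -` A \<in> sets lebesgue"
  unfolding flow_vimage_eq_image by (rule lipschitz_image_sets_lebesgue[OF flow_lipschitz_on])

lemma flow_measurable: "\<phi> t \<in> lebesgue \<rightarrow>\<^sub>M lebesgue"
  by (rule measurableI) (auto intro: flow_vimage_sets)

lemma flow_compose_measurable:
  "f \<in> borel_measurable lebesgue \<Longrightarrow> (\<lambda>x. f (\<phi> t x)) \<in> borel_measurable lebesgue"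
  by (rule measurable_compose[OF flow_measurable])

lemma emeasure_lebesgue_flow_vimage_le:
  assumes "A \<in> sets lebesgue"
  shows "emeasure lebesgue (\<phi> t -` A) \<le> ennreal (exp (real DIM('a) * L * \<bar>t\<bar>)) * emeasure lebesgue A"
  unfolding flow_vimage_eq_image
  using emeasure_lipschitz_image_le[OF flow_lipschitz_on assms, of "-t"]
  by (simp add: exp_of_nat_mult[symmetric] mult.assoc)

end

section \<open>The Koopman group\<close>

lemma abs_average_time_le: "j < n \<Longrightarrow> \<bar>real j * t / real n\<bar> \<le> \<bar>t\<bar>"
  by (simp add: abs_mult divide_le_eq mult.commute mult_left_mono)

locale c1_flow_vec = c1_flow F F' L \<phi>
  for F :: "real^'n \<Rightarrow> real^'n" and F' :: "real^'n \<Rightarrow> (real^'n) \<Rightarrow>\<^sub>L (real^'n)"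
    and L :: real and \<phi> :: "real \<Rightarrow> real^'n \<Rightarrow> real^'n"
begin

abbreviation lie_deriv :: "(real^'n \<Rightarrow> real) \<Rightarrow> real^'n \<Rightarrow> real" where
  "lie_deriv u x \<equiv> F x \<bullet> grad u x"

lemma
  assumes u: "C1c u"
  shows C1c_flow: "C1c (\<lambda>x. u (\<phi> t x))"
    and lie_deriv_flow: "lie_deriv (\<lambda>x. u (\<phi> t x)) x = lie_deriv u (\<phi> t x)"
proof -
  obtain T where T: "\<And>x. (\<phi> t has_derivative T x) (at x)" "\<And>v. continuous_on UNIV (\<lambda>x. T x v)"
    by (rule flow_C1) (rule that)
  define w where "w = (\<lambda>x. u (\<phi> t x))"
  have chain: "(w has_derivative (\<lambda>h. grad u (\<phi> t x) \<bullet> T x h)) (at x)" for x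
    unfolding w_def by (rule has_derivative_compose[OF T(1) C1_has_derivative[OF C1c_imp_C1[OF u]]])
  then have w_deriv: "(w has_derivative (\<lambda>h. grad w x \<bullet> h)) (at x)" for x
    by (intro has_derivative_grad) (auto simp: differentiable_def)
  have grad_w: "grad w x \<bullet> h = grad u (\<phi> t x) \<bullet> T x h" for x h
    using has_derivative_unique[OF chain w_deriv] by metis
  have "grad w = (\<lambda>x. \<chi> i. grad u (\<phi> t x) \<bullet> T x (axis i 1))"
    by (auto simp: fun_eq_iff vec_eq_iff grad_w[symmetric] inner_axis)
  moreover have "continuous_on UNIV (\<lambda>x. \<chi> i. grad u (\<phi> t x) \<bullet> T x (axis i 1))"
    by (intro continuous_intros T
        continuous_on_compose2[OF C1_continuous_grad[OF C1c_imp_C1[OF u], of UNIV] flow_continuous]) auto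
  ultimately have "C1 w" by (intro C1I[OF w_deriv]) simp
  moreover have "bounded {x. w x \<noteq> 0}"
  proof -
    obtain R where R: "\<And>x. norm x > R \<Longrightarrow> u x = 0" by (rule C1c_supportE[OF u]) (rule that)
    obtain R' where R': "\<And>s x. \<bar>s\<bar> \<le> \<bar>t\<bar> \<Longrightarrow> norm (\<phi> s x) \<le> R \<Longrightarrow> norm x \<le> R'"
      by (rule flow_preimage_boundedE[of "\<bar>t\<bar>" R]) (rule that)
    have "norm x \<le> R'" if "w x \<noteq> 0" for x
      using that R[of "\<phi> t x"] R'[of t x] by (force simp: w_def)
    then show ?thesis by (auto simp: bounded_iff)
  qed
  ultimately show "C1c (\<lambda>x. u (\<phi> t x))" by (simp add: C1c_iff w_def)
  show "lie_deriv (\<lambda>x. u (\<phi> t x)) x = lie_deriv u (\<phi> t x)"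
    using grad_w[of x "F x"] flow_derivative_F[OF T(1)] by (simp add: w_def inner_commute)
qed

lemma C1c_flow_deriv:
  "C1c u \<Longrightarrow> ((\<lambda>s. u (\<phi> s x)) has_real_derivative lie_deriv u (\<phi> s x)) (at s)"
  by (intro C1_has_vector_derivative_compose flow_deriv C1c_imp_C1)

lemma lie_deriv_continuous: "C1c u \<Longrightarrow> continuous_on UNIV (lie_deriv u)"
  by (intro continuous_intros F_continuous C1_continuous_grad C1c_imp_C1)

lemma lie_deriv_measurable: "C1c u \<Longrightarrow> lie_deriv u \<in> borel_measurable lebesgue"
  by (rule continuous_borel_measurable_lebesgue[OF lie_deriv_continuous])

lemma lie_deriv_boundedE:
  assumes u: "C1c u"
  obtains B where "B \<ge> 0" "\<And>x. \<bar>lie_deriv u x\<bar> \<le> B"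
proof -
  obtain R where "\<And>x. norm x > R \<Longrightarrow> grad u x = 0" by (rule C1c_supportE[OF u]) (rule that)
  then show thesis
    using continuous_vanishing_outside_bounded[OF lie_deriv_continuous[OF u], of R] that by auto
qed

lemma C1c_flow_time_lipschitz:
  assumes u: "C1c u" and B: "\<And>x. \<bar>lie_deriv u x\<bar> \<le> B"
  shows "\<bar>u (\<phi> s x) - u (\<phi> t x)\<bar> \<le> B * \<bar>s - t\<bar>"
  using field_differentiable_bound[of UNIV "\<lambda>s. u (\<phi> s x)" "\<lambda>s. lie_deriv u (\<phi> s x)" B s t]
    C1c_flow_deriv[OF u] B by auto

abbreviation flow_quotient :: "real \<Rightarrow> (real^'n \<Rightarrow> real) \<Rightarrow> real^'n \<Rightarrow> real" where
  "flow_quotient t f x \<equiv> (f (\<phi> t x) - f x) / t"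

lemma flow_quotient_tendsto:
  assumes "C1c u"
  shows "((\<lambda>t. flow_quotient t u x) \<longlongrightarrow> lie_deriv u x) (at 0)"
  using C1c_flow_deriv[OF assms, of x 0] by (simp add: DERIV_def)

lemma abs_flow_quotient_le:
  assumes "C1c u" "\<And>x. \<bar>lie_deriv u x\<bar> \<le> B"
  shows "\<bar>flow_quotient t u x\<bar> \<le> B"
  using C1c_flow_time_lipschitz[OF assms, of t x 0] order_trans[OF abs_ge_zero assms(2)]
  by (cases "t = 0") (simp_all add: divide_le_eq)

definition flow_average :: "nat \<Rightarrow> real \<Rightarrow> (real^'n \<Rightarrow> real) \<Rightarrow> real^'n \<Rightarrow> real" where
  "flow_average n t w x = (\<Sum>j<n. w (\<phi> (real j * t / real n) x)) / real n"

lemma C1c_flow_average: "C1c v \<Longrightarrow> C1c (flow_average n t v)"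
  unfolding flow_average_def[abs_def] by (intro C1c_divide C1c_sum C1c_flow) auto

lemma lie_deriv_flow_average:
  assumes v: "C1c v"
  shows "lie_deriv (flow_average n t v) x = flow_average n t (lie_deriv v) x"
proof -
  have C1: "C1 (\<lambda>x. v (\<phi> s x))" for s by (rule C1c_imp_C1[OF C1c_flow[OF v]])
  have "grad (flow_average n t v) x = (\<Sum>j<n. grad (\<lambda>x. v (\<phi> (real j * t / real n) x)) x) /\<^sub>R real n"
    unfolding flow_average_def[abs_def] by (simp only: grad_divide[OF C1_sum[OF C1]] grad_sum[OF C1])
  then show ?thesis
    by (simp add: inner_sum_right lie_deriv_flow[OF v] flow_average_def divide_inverse_commute)
qed

lemma flow_average_flow_quotient:
  assumes "n > 0"
  shows "flow_average n t (flow_quotient (t / real n) f) x = flow_quotient t f x"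
proof -
  let ?h = "t / real n"
  have "(\<Sum>j<n. f (\<phi> ?h (\<phi> (real j * t / real n) x)) - f (\<phi> (real j * t / real n) x))
      = (\<Sum>j<n. f (\<phi> (real (Suc j) * ?h) x) - f (\<phi> (real j * ?h) x))"
    by (simp add: flow_flow algebra_simps add_divide_distrib)
  also have "\<dots> = f (\<phi> t x) - f x"
    using sum_lessThan_telescope[of "\<lambda>j. f (\<phi> (real j * ?h) x)" n] assms by simp
  finally show ?thesis
    using assms by (simp add: flow_average_def sum_divide_distrib[symmetric] sum_distrib_right[symmetric])
qed

end

locale koopman = c1_flow_vec F F' L \<phi>
  for F :: "real^'n \<Rightarrow> real^'n" and F' :: "real^'n \<Rightarrow> (real^'n) \<Rightarrow>\<^sub>L (real^'n)"
    and L :: real and \<phi> :: "real \<Rightarrow> real^'n \<Rightarrow> real^'n" +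
  fixes M :: "(real^'n) measure" and c :: real
  assumes sets_M: "sets M = sets lebesgue"
    and absolutely_continuous_M: "absolutely_continuous lebesgue M"
    and finite_cball: "\<And>R. emeasure M (cball 0 R) < \<infinity>"
    and c_nonneg: "c \<ge> 0"
    and emeasure_flow_vimage_le: "\<And>A t. A \<in> sets lebesgue \<Longrightarrow>
      emeasure M (\<phi> t -` A) \<le> ennreal (exp (c * \<bar>t\<bar>)) * emeasure M A"
begin

lemma borel_measurable_M: "borel_measurable M = borel_measurable lebesgue"
  by (rule measurable_cong_sets[OF sets_M refl])

lemma flow_measurable_M: "\<phi> t \<in> M \<rightarrow>\<^sub>M M"
  using flow_measurable measurable_cong_sets[OF sets_M sets_M] by blast

lemma AE_M: "AE x in lebesgue. Q x \<Longrightarrow> AE x in M. Q x"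
  by (rule absolutely_continuous_AE[OF sets_M absolutely_continuous_M])

lemma flow_AE:
  assumes "AE x in M. Q x"
  shows "AE x in M. Q (\<phi> t x)"
proof -
  obtain N where N: "{x \<in> space M. \<not> Q x} \<subseteq> N" "emeasure M N = 0" "N \<in> sets M"
    using assms by (rule AE_E)
  then have "\<phi> t -` N \<in> null_sets M"
    using emeasure_flow_vimage_le[of N t] flow_vimage_sets[of N t] by (simp add: null_sets_def sets_M)
  moreover have "{x \<in> space M. \<not> Q (\<phi> t x)} \<subseteq> \<phi> t -` N"
    using N(1) measurable_space[OF flow_measurable_M] by auto
  ultimately show ?thesis by (rule AE_I')
qed

lemma nn_integral_flow_le:
  assumes f: "f \<in> borel_measurable lebesgue"
  shows "(\<integral>\<^sup>+x. f (\<phi> t x) \<partial>M) \<le> ennreal (exp (c * \<bar>t\<bar>)) * (\<integral>\<^sup>+x. f x \<partial>M)"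
proof -
  have f_M: "f \<in> borel_measurable M" using f by (simp add: borel_measurable_M)
  have "distr M M (\<phi> t) \<le> scale_measure (ennreal (exp (c * \<bar>t\<bar>))) M"
    using emeasure_flow_vimage_le sets_eq_imp_space_eq[OF sets_M]
    by (subst le_measure) (auto simp: emeasure_distr[OF flow_measurable_M] sets_M)
  then have "nn_integral (distr M M (\<phi> t)) f \<le> nn_integral (scale_measure (ennreal (exp (c * \<bar>t\<bar>))) M) f"
    by (intro nn_integral_mono_measure) auto
  then show ?thesis
    by (simp add: nn_integral_distr[OF flow_measurable_M] nn_integral_scale_measure f_M)
qed

definition growth :: "real \<Rightarrow> real" where
  "growth t = exp (c / 2 * \<bar>t\<bar>)"

lemma growth_ge_1: "growth t \<ge> 1"
  using c_nonneg by (simp add: growth_def)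

lemma growth_mono: "\<bar>s\<bar> \<le> \<bar>t\<bar> \<Longrightarrow> growth s \<le> growth t"
  using c_nonneg by (simp add: growth_def mult_left_mono)

lemma
  assumes f: "f \<in> L2 M"
  shows flow_L2: "(\<lambda>x. f (\<phi> t x)) \<in> L2 M"
    and l2norm_flow_le: "l2norm M (\<lambda>x. f (\<phi> t x)) \<le> growth t * l2norm M f"
proof -
  have f_meas: "f \<in> borel_measurable lebesgue" using L2_measurable[OF f] by (simp add: borel_measurable_M)
  then have ft_meas: "(\<lambda>x. f (\<phi> t x)) \<in> borel_measurable M"
    unfolding borel_measurable_M by (rule flow_compose_measurable)
  have "(\<integral>\<^sup>+x. ennreal ((f (\<phi> t x))\<^sup>2) \<partial>M) \<le> ennreal (exp (c * \<bar>t\<bar>)) * (\<integral>\<^sup>+x. ennreal ((f x)\<^sup>2) \<partial>M)"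
    using f_meas by (intro nn_integral_flow_le) measurable
  also have "\<dots> = ennreal ((growth t * l2norm M f)\<^sup>2)"
    using nn_integral_eq_integral[OF L2_integrable_square[OF f]]
    by (simp add: power_mult_distrib l2norm_square growth_def exp_double[symmetric] ennreal_mult)
  finally have bound: "(\<integral>\<^sup>+x. ennreal ((f (\<phi> t x))\<^sup>2) \<partial>M) \<le> ennreal ((growth t * l2norm M f)\<^sup>2)" .
  have int: "integrable M (\<lambda>x. (f (\<phi> t x))\<^sup>2)"
    unfolding integrable_iff_bounded
  proof
    show "(\<lambda>x. (f (\<phi> t x))\<^sup>2) \<in> borel_measurable M" using ft_meas by measurable
    show "(\<integral>\<^sup>+x. ennreal (norm ((f (\<phi> t x))\<^sup>2)) \<partial>M) < \<infinity>"
      using le_less_trans[OF bound] by simp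
  qed
  with ft_meas show "(\<lambda>x. f (\<phi> t x)) \<in> L2 M" by (simp add: L2_def)
  have "(l2norm M (\<lambda>x. f (\<phi> t x)))\<^sup>2 \<le> (growth t * l2norm M f)\<^sup>2"
    using bound nn_integral_eq_integral[OF int] by (simp add: l2norm_square)
  then show "l2norm M (\<lambda>x. f (\<phi> t x)) \<le> growth t * l2norm M f"
    by (rule power2_le_imp_le) (use growth_ge_1[of t] in simp)
qed

lemma l2norm_flow_diff_le:
  assumes f: "f \<in> L2 M" and g: "g \<in> L2 M"
  shows "l2norm M (\<lambda>x. f (\<phi> t x) - g x) \<le> growth t * l2norm M (\<lambda>x. f x - g x) + l2norm M (\<lambda>x. g (\<phi> t x) - g x)"
  using l2norm_diff_triangle[OF flow_L2[OF f] flow_L2[OF g] g, of t t] l2norm_flow_le[OF L2_diff[OF f g], of t]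
  by simp

lemma cball_indicator_L2: "(\<lambda>x. B * indicator (cball 0 R) x) \<in> L2 M"
proof -
  have "integrable M (indicator (cball 0 R) :: real^'n \<Rightarrow> real)"
    using finite_cball by (intro integrable_real_indicator) (auto simp: sets_M)
  moreover have "(\<lambda>x. (indicator (cball 0 R) x)\<^sup>2) = (indicator (cball 0 R) :: real^'n \<Rightarrow> real)"
    by (auto simp: indicator_def)
  ultimately have "indicator (cball 0 R) \<in> L2 M" by (auto simp: L2_def)
  then show ?thesis by (rule L2_scale)
qed

lemma bounded_support_L2:
  assumes "f \<in> borel_measurable lebesgue" "\<And>x. \<bar>f x\<bar> \<le> B" "\<And>x. norm x > R \<Longrightarrow> f x = 0"
  shows "f \<in> L2 M"
  by (rule L2_bound[OF _ cball_indicator_L2[of B R]])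
    (use assms in \<open>auto simp: borel_measurable_M indicator_def intro: order_trans[OF _ abs_ge_self]\<close>)

lemma C1c_L2: "C1c u \<Longrightarrow> u \<in> L2 M"
  using C1c_boundedE C1c_supportE C1c_measurable bounded_support_L2 by metis

lemma lie_deriv_L2:
  assumes u: "C1c u"
  shows "lie_deriv u \<in> L2 M"
proof -
  obtain B where B: "\<And>x. \<bar>lie_deriv u x\<bar> \<le> B" by (rule lie_deriv_boundedE[OF u]) (rule that)
  obtain R where "\<And>x. norm x > R \<Longrightarrow> grad u x = 0" by (rule C1c_supportE[OF u]) (rule that)
  then show ?thesis by (intro bounded_support_L2[OF lie_deriv_measurable[OF u] B, of R]) simp
qed

lemma flow_quotient_L2: "f \<in> L2 M \<Longrightarrow> flow_quotient t f \<in> L2 M"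
  by (intro L2_divide L2_diff flow_L2)

lemma bounded_measurable_approx_C1c_L2:
  assumes f: "f \<in> borel_measurable lebesgue" "\<And>x. \<bar>f x\<bar> \<le> B" "\<And>x. norm x > R \<Longrightarrow> f x = 0"
    and "R \<ge> 0"
  obtains u where "\<And>k::nat. C1c (u k)" "\<And>k x. \<bar>u k x\<bar> \<le> B + 1"
    "AE x in M. (\<lambda>k. u k x) \<longlonglongrightarrow> f x" "(\<lambda>k. l2norm M (\<lambda>x. u k x - f x)) \<longlonglongrightarrow> 0"
proof -
  obtain u where u: "\<And>k::nat. C1c (u k)" "\<And>k x. \<bar>u k x\<bar> \<le> B + 1" "\<And>k x. norm x > R + 1 \<Longrightarrow> u k x = 0"
    "AE x in lebesgue. (\<lambda>k. u k x) \<longlonglongrightarrow> f x"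
    using bounded_measurable_approx_C1c[OF f \<open>R \<ge> 0\<close>] by blast
  note lim = AE_M[OF u(4)]
  have "(\<lambda>k. l2norm M (\<lambda>x. u k x - f x)) \<longlonglongrightarrow> 0"
  proof (rule l2norm_dominated_convergence[OF _ cball_indicator_L2[of "2 * B + 1" "R + 1"]])
    show "(\<lambda>x. u k x - f x) \<in> borel_measurable M" for k
      unfolding borel_measurable_M by (intro borel_measurable_diff C1c_measurable u f)
    show "AE x in M. (\<lambda>k. u k x - f x) \<longlonglongrightarrow> 0"
      using lim by eventually_elim (rule LIM_zero)
    show "\<bar>u k x - f x\<bar> \<le> \<bar>(2 * B + 1) * indicator (cball 0 (R + 1)) x\<bar>" for k x
    proof (cases "norm x \<le> R + 1")
      case True
      then show ?thesis using u(2)[of k x] f(2)[of x] by simp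
    qed (use u(3)[of x k] f(3)[of x] in simp)
  qed
  with u lim that show thesis by blast
qed

lemma C1c_dense:
  assumes f: "f \<in> L2 M" and "e > 0"
  obtains u where "C1c u" "l2norm M (\<lambda>x. u x - f x) < e"
proof -
  define g where "g n x = clip (real n) (f x) * indicator (cball 0 (real n)) x" for n :: nat and x :: "real^'n"
  have f_meas: "f \<in> borel_measurable lebesgue" using L2_measurable[OF f] by (simp add: borel_measurable_M)
  have g_meas: "g n \<in> borel_measurable lebesgue" for n
    unfolding g_def by (intro borel_measurable_times borel_measurable_clip f_meas borel_measurable_indicator) simp
  have g_le: "\<bar>g n x\<bar> \<le> real n" for n x
    using abs_clip_le[of "real n" "f x"] by (auto simp: g_def indicator_def)
  have g_support: "norm x > real n \<Longrightarrow> g n x = 0" for n x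
    by (simp add: g_def)
  have g_L2: "g n \<in> L2 M" for n
    by (rule bounded_support_L2[OF g_meas g_le g_support])
  have "(\<lambda>n. l2norm M (\<lambda>x. g n x - f x)) \<longlonglongrightarrow> 0"
  proof (rule l2norm_dominated_convergence[OF _ f])
    show "(\<lambda>x. g n x - f x) \<in> borel_measurable M" for n
      using g_meas f_meas unfolding borel_measurable_M by (intro borel_measurable_diff)
    show "AE x in M. (\<lambda>n. g n x - f x) \<longlonglongrightarrow> 0"
    proof (rule AE_I2)
      fix x :: "real^'n"
      have "\<forall>\<^sub>F n in sequentially. real n \<ge> norm x"
        using filterlim_real_sequentially by (simp add: filterlim_at_top)
      then have "\<forall>\<^sub>F n in sequentially. g n x - f x = 0"
        using eventually_clip_eq[of "f x"] by eventually_elim (simp add: g_def)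
      then show "(\<lambda>n. g n x - f x) \<longlonglongrightarrow> 0" by (rule tendsto_eventually)
    qed
    show "\<bar>g n x - f x\<bar> \<le> \<bar>f x\<bar>" for n x
      using abs_diff_clip_le[of "real n" "f x"] by (auto simp: g_def indicator_def abs_minus_commute)
  qed
  then obtain n where n: "l2norm M (\<lambda>x. g n x - f x) < e / 2"
    by (rule LIMSEQ_null_lessE[of _ "e / 2"]) (use \<open>e > 0\<close> that in auto)
  obtain u where u: "\<And>k::nat. C1c (u k)" "(\<lambda>k. l2norm M (\<lambda>x. u k x - g n x)) \<longlonglongrightarrow> 0"
    by (rule bounded_measurable_approx_C1c_L2[of "g n" "real n" "real n"])
      (auto intro: g_meas g_le g_support that)
  obtain k where k: "l2norm M (\<lambda>x. u k x - g n x) < e / 2"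
    by (rule LIMSEQ_null_lessE[OF u(2), of "e / 2"]) (use \<open>e > 0\<close> that in auto)
  have "l2norm M (\<lambda>x. u k x - f x) < e"
    using l2norm_diff_triangle[OF C1c_L2[OF u(1)] g_L2 f, of k n] n k by simp
  with u(1) that show thesis by blast
qed

lemma C1c_flow_quotient_tendsto_L2:
  assumes u: "C1c u"
  shows "((\<lambda>t. l2norm M (\<lambda>x. flow_quotient t u x - lie_deriv u x)) \<longlongrightarrow> 0) (at 0)"
proof -
  obtain B where B: "B \<ge> 0" "\<And>x. \<bar>lie_deriv u x\<bar> \<le> B" by (rule lie_deriv_boundedE[OF u]) (rule that)
  obtain R where R: "\<And>x. norm x > R \<Longrightarrow> u x = 0" "\<And>x. norm x > R \<Longrightarrow> grad u x = 0"
    by (rule C1c_supportE[OF u]) (rule that)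
  obtain R' where R': "\<And>t x. \<bar>t\<bar> \<le> 1 \<Longrightarrow> norm (\<phi> t x) \<le> R \<Longrightarrow> norm x \<le> R'"
    by (rule flow_preimage_boundedE[of 1 R]) (rule that)
  show ?thesis
  proof (rule l2norm_dominated_convergence_at[OF _ cball_indicator_L2[of "2 * B" "max R R'"]])
    show "(\<lambda>x. flow_quotient t u x - lie_deriv u x) \<in> borel_measurable M" for t
      by (intro L2_measurable L2_diff flow_quotient_L2 C1c_L2 lie_deriv_L2 u)
    show "((\<lambda>t. flow_quotient t u x - lie_deriv u x) \<longlongrightarrow> 0) (at 0)" for x
      by (rule LIM_zero[OF flow_quotient_tendsto[OF u]])
    have "\<bar>flow_quotient t u x - lie_deriv u x\<bar> \<le> \<bar>2 * B * indicator (cball 0 (max R R')) x\<bar>"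
      if "\<bar>t\<bar> < 1" for t x
    proof (cases "norm x \<le> max R R'")
      case True
      have "\<bar>flow_quotient t u x - lie_deriv u x\<bar> \<le> 2 * B"
        using abs_flow_quotient_le[OF u B(2), of t x] B(2)[of x] by linarith
      then show ?thesis using True B(1) by simp
    next
      case False
      then have "norm (\<phi> t x) > R" using R'[of t x] that by force
      then show ?thesis using False R by simp
    qed
    then show "\<forall>\<^sub>F t in at 0. \<forall>x. \<bar>flow_quotient t u x - lie_deriv u x\<bar> \<le> \<bar>2 * B * indicator (cball 0 (max R R')) x\<bar>"
      unfolding eventually_at by (intro exI[of _ 1]) (auto simp: dist_real_def)
  qed
qed

lemma C1c_strongly_continuous:
  assumes u: "C1c u"
  shows "((\<lambda>t. l2norm M (\<lambda>x. u (\<phi> t x) - u x)) \<longlongrightarrow> 0) (at 0)"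
proof (rule Lim_null_comparison)
  note u_L2 = C1c_L2[OF u] and lie_L2 = lie_deriv_L2[OF u]
  let ?b = "\<lambda>t. \<bar>t\<bar> * (l2norm M (\<lambda>x. flow_quotient t u x - lie_deriv u x) + l2norm M (lie_deriv u))"
  have "(?b \<longlongrightarrow> \<bar>0\<bar> * (0 + l2norm M (lie_deriv u))) (at 0)"
    by (intro tendsto_intros C1c_flow_quotient_tendsto_L2 u)
  then show "(?b \<longlongrightarrow> 0) (at 0)" by simp
  show "\<forall>\<^sub>F t in at 0. norm (l2norm M (\<lambda>x. u (\<phi> t x) - u x)) \<le> ?b t"
    unfolding eventually_at_filter
  proof (intro always_eventually allI impI)
    fix t :: real assume "t \<noteq> 0"
    then have "l2norm M (\<lambda>x. u (\<phi> t x) - u x) = \<bar>t\<bar> * l2norm M (flow_quotient t u)"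
      by (simp add: l2norm_divide)
    also have "\<dots> \<le> ?b t"
      using l2norm_triangle[OF L2_diff[OF flow_quotient_L2[OF u_L2] lie_L2] lie_L2, of t] by (intro mult_left_mono) auto
    finally show "norm (l2norm M (\<lambda>x. u (\<phi> t x) - u x)) \<le> ?b t" by simp
  qed
qed

lemma strongly_continuousE:
  assumes f: "f \<in> L2 M" and "e > 0"
  obtains \<tau> where "\<tau> > 0" "\<And>s. \<bar>s\<bar> < \<tau> \<Longrightarrow> l2norm M (\<lambda>x. f (\<phi> s x) - f x) < e"
proof -
  have "growth 1 \<ge> 1" by (rule growth_ge_1)
  obtain u where u: "C1c u" "l2norm M (\<lambda>x. u x - f x) < e / (3 * growth 1)"
    by (rule C1c_dense[OF f, of "e / (3 * growth 1)"]) (use \<open>e > 0\<close> \<open>growth 1 \<ge> 1\<close> in auto)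
  then have approx: "growth 1 * l2norm M (\<lambda>x. f x - u x) < e / 3"
    using \<open>growth 1 \<ge> 1\<close> by (simp add: field_simps l2norm_minus_commute[of M f u])
  have "\<forall>\<^sub>F t in at 0. l2norm M (\<lambda>x. u (\<phi> t x) - u x) < e / 3"
    by (rule order_tendstoD(2)[OF C1c_strongly_continuous[OF u(1)]]) (use \<open>e > 0\<close> in simp)
  then obtain \<tau> where "\<tau> > 0" and \<tau>: "\<And>t. t \<noteq> 0 \<Longrightarrow> \<bar>t\<bar> < \<tau> \<Longrightarrow> l2norm M (\<lambda>x. u (\<phi> t x) - u x) < e / 3"
    unfolding eventually_at by (auto simp: dist_real_def)
  show thesis
  proof (rule that[of "min 1 \<tau>"])
    fix s :: real assume s: "\<bar>s\<bar> < min 1 \<tau>"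
    have "l2norm M (\<lambda>x. f (\<phi> s x) - f x) \<le> l2norm M (\<lambda>x. f (\<phi> s x) - u x) + l2norm M (\<lambda>x. u x - f x)"
      by (intro l2norm_diff_triangle flow_L2 f C1c_L2 u)
    moreover have "l2norm M (\<lambda>x. f (\<phi> s x) - u x)
        \<le> growth s * l2norm M (\<lambda>x. f x - u x) + l2norm M (\<lambda>x. u (\<phi> s x) - u x)"
      by (intro l2norm_flow_diff_le f C1c_L2 u)
    moreover have "growth s * l2norm M (\<lambda>x. f x - u x) \<le> growth 1 * l2norm M (\<lambda>x. f x - u x)"
      using s by (intro mult_right_mono growth_mono) auto
    moreover have "l2norm M (\<lambda>x. u x - f x) \<le> growth 1 * l2norm M (\<lambda>x. f x - u x)"
      using mult_right_mono[OF \<open>growth 1 \<ge> 1\<close> l2norm_nonneg[of M "\<lambda>x. f x - u x"]]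
      by (simp add: l2norm_minus_commute[of M f u])
    moreover have "l2norm M (\<lambda>x. u (\<phi> s x) - u x) < e / 3"
      using \<tau>[of s] s \<open>e > 0\<close> by (cases "s = 0") auto
    ultimately show "l2norm M (\<lambda>x. f (\<phi> s x) - f x) < e" using approx by linarith
  qed (use \<open>\<tau> > 0\<close> in simp)
qed

lemma sc_group_flow: "sc_group M (\<lambda>t f x. f (\<phi> t x))"
  unfolding sc_group_def
proof (intro conjI allI ballI impI)
  show "\<exists>C. \<forall>f\<in>L2 M. l2norm M (\<lambda>x. f (\<phi> t x)) \<le> C * l2norm M f" for t
    using l2norm_flow_le by blast
  show "((\<lambda>t. l2norm M (\<lambda>x. f (\<phi> t x) - f (\<phi> t0 x))) \<longlongrightarrow> 0) (at t0)" if f: "f \<in> L2 M" for f t0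
  proof (rule tendstoI)
    fix e :: real assume "e > 0"
    obtain \<tau> where "\<tau> > 0" and \<tau>: "\<And>s. \<bar>s\<bar> < \<tau> \<Longrightarrow> l2norm M (\<lambda>x. f (\<phi> t0 (\<phi> s x)) - f (\<phi> t0 x)) < e"
      by (rule strongly_continuousE[OF flow_L2[OF f, of t0] \<open>e > 0\<close>]) (rule that)
    have "l2norm M (\<lambda>x. f (\<phi> t x) - f (\<phi> t0 x)) < e" if "\<bar>t - t0\<bar> < \<tau>" for t
      using \<tau>[OF that] by (simp add: flow_flow)
    with \<open>\<tau> > 0\<close> show "\<forall>\<^sub>F t in at t0. dist (l2norm M (\<lambda>x. f (\<phi> t x) - f (\<phi> t0 x))) 0 < e"
      unfolding eventually_at by (intro exI[of _ \<tau>]) (simp add: dist_real_def)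
  qed
  show "AE x in M. f (\<phi> (s + t) x) = f (\<phi> t (\<phi> s x))" for f s t
    by (simp add: flow_flow add.commute[of s t])
  show "AE x in M. f (\<phi> t x) = g (\<phi> t x)" if "AE x in M. f x = g x" for f g t
    by (rule flow_AE[OF that])
qed (auto intro: flow_L2)

lemma flow_average_L2: "f \<in> L2 M \<Longrightarrow> flow_average n t f \<in> L2 M"
  unfolding flow_average_def[abs_def] by (intro L2_divide L2_sum flow_L2)

lemma l2norm_flow_average_diff_le:
  assumes w: "w \<in> L2 M" and f: "f \<in> L2 M" and "n > 0"
    and b: "\<And>s. \<bar>s\<bar> \<le> \<bar>t\<bar> \<Longrightarrow> l2norm M (\<lambda>x. f (\<phi> s x) - f x) \<le> b"
  shows "l2norm M (\<lambda>x. flow_average n t w x - f x) \<le> growth t * l2norm M (\<lambda>x. w x - f x) + b"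
proof -
  have shifted: "l2norm M (\<lambda>x. w (\<phi> s x) - f x) \<le> growth t * l2norm M (\<lambda>x. w x - f x) + b" if s: "\<bar>s\<bar> \<le> \<bar>t\<bar>" for s
    by (rule order_trans[OF l2norm_flow_diff_le[OF w f]]) (intro add_mono mult_right_mono growth_mono b s l2norm_nonneg)
  have "l2norm M (\<lambda>x. (\<Sum>j<n. w (\<phi> (real j * t / real n) x) - f x) / real n)
      \<le> growth t * l2norm M (\<lambda>x. w x - f x) + b"
    by (intro l2norm_average_le \<open>n > 0\<close> L2_diff flow_L2 w f shifted abs_average_time_le)
  moreover have "(\<lambda>x. (\<Sum>j<n. w (\<phi> (real j * t / real n) x) - f x) / real n) = (\<lambda>x. flow_average n t w x - f x)"
    using \<open>n > 0\<close> by (simp add: flow_average_def sum_subtractf diff_divide_distrib)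
  ultimately show ?thesis by simp
qed

lemma flow_average_lie_deriv_tendsto:
  assumes u: "C1c u" and "t \<noteq> 0"
  shows "(\<lambda>n. l2norm M (\<lambda>x. flow_average n t (lie_deriv u) x - flow_quotient t u x)) \<longlonglongrightarrow> 0"
proof (rule Lim_null_comparison)
  note u_L2 = C1c_L2[OF u] and lie_L2 = lie_deriv_L2[OF u]
  let ?r = "\<lambda>h. l2norm M (\<lambda>x. flow_quotient h u x - lie_deriv u x)"
  have "filterlim (\<lambda>n. t / real n) (at 0) sequentially"
    unfolding filterlim_at using lim_const_over_n[of t] \<open>t \<noteq> 0\<close>
    by (auto intro: eventually_mono[OF eventually_gt_at_top[of 0]])
  then have "(\<lambda>n. growth t * ?r (t / real n)) \<longlonglongrightarrow> growth t * 0"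
    by (intro tendsto_mult_left filterlim_compose[OF C1c_flow_quotient_tendsto_L2[OF u]])
  then show "(\<lambda>n. growth t * ?r (t / real n)) \<longlonglongrightarrow> 0" by simp
  have "l2norm M (\<lambda>x. flow_average n t (lie_deriv u) x - flow_quotient t u x) \<le> growth t * ?r (t / real n)"
    if "n > 0" for n
  proof -
    let ?w = "\<lambda>x. lie_deriv u x - flow_quotient (t / real n) u x"
    have "l2norm M (\<lambda>x. flow_average n t ?w x - 0) \<le> growth t * l2norm M (\<lambda>x. ?w x - 0) + 0"
      by (intro l2norm_flow_average_diff_le L2_zero L2_diff lie_L2 flow_quotient_L2 u_L2 \<open>n > 0\<close>) simp
    moreover have "flow_average n t ?w x = flow_average n t (lie_deriv u) x - flow_quotient t u x" for x
      unfolding flow_average_flow_quotient[OF \<open>n > 0\<close>, of t u, symmetric]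
      by (simp add: flow_average_def sum_subtractf diff_divide_distrib)
    ultimately show ?thesis
      by (simp only: diff_zero add_0_right l2norm_minus_commute[of M "lie_deriv u"])
  qed
  then show "\<forall>\<^sub>F n in sequentially. norm (l2norm M (\<lambda>x. flow_average n t (lie_deriv u) x - flow_quotient t u x))
      \<le> growth t * ?r (t / real n)"
    by (intro eventually_mono[OF eventually_gt_at_top[of 0]]) simp
qed


lemma C1c_flow_quotient_diff_le:
  assumes u: "C1c u" and g: "g \<in> L2 M" and "t \<noteq> 0"
    and b: "\<And>s. \<bar>s\<bar> \<le> \<bar>t\<bar> \<Longrightarrow> l2norm M (\<lambda>x. g (\<phi> s x) - g x) \<le> b"
  shows "l2norm M (\<lambda>x. flow_quotient t u x - g x) \<le> growth t * l2norm M (\<lambda>x. lie_deriv u x - g x) + b"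
proof (rule LIMSEQ_le_const)
  let ?bound = "growth t * l2norm M (\<lambda>x. lie_deriv u x - g x) + b"
  let ?r = "\<lambda>n. l2norm M (\<lambda>x. flow_average n t (lie_deriv u) x - flow_quotient t u x)"
  have "(\<lambda>n. ?r n + ?bound) \<longlonglongrightarrow> 0 + ?bound"
    by (intro tendsto_add tendsto_const flow_average_lie_deriv_tendsto u \<open>t \<noteq> 0\<close>)
  then show "(\<lambda>n. ?r n + ?bound) \<longlonglongrightarrow> ?bound" by simp
  have "l2norm M (\<lambda>x. flow_quotient t u x - g x) \<le> ?r n + ?bound" if "n > 0" for n
  proof -
    have "l2norm M (\<lambda>x. flow_quotient t u x - g x) \<le> l2norm M (\<lambda>x. flow_quotient t u x - flow_average n t (lie_deriv u) x)
        + l2norm M (\<lambda>x. flow_average n t (lie_deriv u) x - g x)"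
      by (intro l2norm_diff_triangle flow_quotient_L2 flow_average_L2 C1c_L2 lie_deriv_L2 u g)
    also have "\<dots> \<le> ?r n + ?bound"
      unfolding l2norm_minus_commute[of M "flow_quotient t u"]
      by (intro add_left_mono l2norm_flow_average_diff_le lie_deriv_L2 u g \<open>n > 0\<close> b)
    finally show ?thesis .
  qed
  then show "\<exists>N. \<forall>n\<ge>N. l2norm M (\<lambda>x. flow_quotient t u x - g x) \<le> ?r n + ?bound"
    by (intro exI[of _ 1]) auto
qed

lemma l2norm_flow_quotient_diff_le:
  assumes f: "f \<in> L2 M" and g: "g \<in> L2 M"
  shows "l2norm M (\<lambda>x. flow_quotient t f x - flow_quotient t g x) \<le> (growth t + 1) * l2norm M (\<lambda>x. f x - g x) / \<bar>t\<bar>"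
proof -
  let ?w = "\<lambda>x. f x - g x"
  have w: "?w \<in> L2 M" by (rule L2_diff[OF f g])
  have "(\<lambda>x. flow_quotient t f x - flow_quotient t g x) = flow_quotient t ?w"
    by (auto simp: diff_divide_distrib)
  then have "l2norm M (\<lambda>x. flow_quotient t f x - flow_quotient t g x) = l2norm M (\<lambda>x. ?w (\<phi> t x) - ?w x) / \<bar>t\<bar>"
    by (simp only: l2norm_divide)
  also have "\<dots> \<le> (growth t + 1) * l2norm M ?w / \<bar>t\<bar>"
    using l2norm_diff_le[OF flow_L2[OF w, of t] w] l2norm_flow_le[OF w, of t]
    by (intro divide_right_mono) (simp_all add: distrib_right)
  finally show ?thesis .
qed

lemma closure_flow_quotient_diff_le:
  assumes closure: "closure_rel M F f g" and "t \<noteq> 0"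
    and b: "\<And>s. \<bar>s\<bar> \<le> \<bar>t\<bar> \<Longrightarrow> l2norm M (\<lambda>x. g (\<phi> s x) - g x) \<le> b"
  shows "l2norm M (\<lambda>x. flow_quotient t f x - g x) \<le> b"
proof -
  obtain u where f: "f \<in> L2 M" and g: "g \<in> L2 M" and u: "\<And>k::nat. C1c (u k)"
    and lim: "(\<lambda>k. l2norm M (\<lambda>x. u k x - f x)) \<longlonglongrightarrow> 0"
      "(\<lambda>k. l2norm M (\<lambda>x. lie_deriv (u k) x - g x)) \<longlonglongrightarrow> 0"
    using closure unfolding closure_rel_def by auto
  let ?bound = "\<lambda>k. (growth t + 1) * l2norm M (\<lambda>x. u k x - f x) / \<bar>t\<bar>
      + (growth t * l2norm M (\<lambda>x. lie_deriv (u k) x - g x) + b)"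
  have "l2norm M (\<lambda>x. flow_quotient t f x - g x) \<le> ?bound k" for k
  proof -
    have "l2norm M (\<lambda>x. flow_quotient t f x - g x)
        \<le> l2norm M (\<lambda>x. flow_quotient t f x - flow_quotient t (u k) x) + l2norm M (\<lambda>x. flow_quotient t (u k) x - g x)"
      by (intro l2norm_diff_triangle flow_quotient_L2 f g C1c_L2 u)
    also have "\<dots> \<le> ?bound k"
      unfolding l2norm_minus_commute[of M "u k" f]
      by (intro add_mono l2norm_flow_quotient_diff_le C1c_flow_quotient_diff_le f g u C1c_L2 \<open>t \<noteq> 0\<close> b)
    finally show ?thesis .
  qed
  moreover have "?bound \<longlonglongrightarrow> (growth t + 1) * 0 / \<bar>t\<bar> + (growth t * 0 + b)"
    using \<open>t \<noteq> 0\<close> by (intro tendsto_intros lim) auto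
  ultimately show ?thesis by (auto intro: LIMSEQ_le_const)
qed

lemma closure_imp_generator:
  assumes closure: "closure_rel M F f g"
  shows "generator_rel M (\<lambda>t f x. f (\<phi> t x)) f g"
proof -
  have f: "f \<in> L2 M" and g: "g \<in> L2 M" using closure by (auto simp: closure_rel_def)
  have "((\<lambda>t. l2norm M (\<lambda>x. flow_quotient t f x - g x)) \<longlongrightarrow> 0) (at 0)"
  proof (rule tendstoI)
    fix e :: real assume "e > 0"
    obtain \<tau> where "\<tau> > 0" and \<tau>: "\<And>s. \<bar>s\<bar> < \<tau> \<Longrightarrow> l2norm M (\<lambda>x. g (\<phi> s x) - g x) < e / 2"
      by (rule strongly_continuousE[OF g, of "e / 2"]) (use \<open>e > 0\<close> that in auto)
    have "l2norm M (\<lambda>x. flow_quotient t f x - g x) \<le> e / 2" if "t \<noteq> 0" "\<bar>t\<bar> < \<tau>" for t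
      by (intro closure_flow_quotient_diff_le[OF closure] less_imp_le[OF \<tau>]) (use that in auto)
    with \<open>\<tau> > 0\<close> \<open>e > 0\<close> show "\<forall>\<^sub>F t in at 0. dist (l2norm M (\<lambda>x. flow_quotient t f x - g x)) 0 < e"
      unfolding eventually_at by (intro exI[of _ \<tau>]) (fastforce simp: dist_real_def)
  qed
  with f g show ?thesis by (simp add: generator_rel_def)
qed

text \<open>Averages of \<open>v \<circ> \<phi> s\<close> over \<open>s \<in> [0, t]\<close> approximate elements of the generator domain in the graph
  norm; replacing them by Riemann sums keeps the approximants among the test functions.\<close>

lemma flow_average_graph_approx:
  assumes f: "f \<in> L2 M" and g: "g \<in> L2 M" and "t \<noteq> 0" "b > 0"
    and orbit: "\<And>s. \<bar>s\<bar> \<le> \<bar>t\<bar> \<Longrightarrow> l2norm M (\<lambda>x. f (\<phi> s x) - f x) \<le> b"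
    and quotient: "l2norm M (\<lambda>x. flow_quotient t f x - g x) \<le> b"
  obtains u where "C1c u" "l2norm M (\<lambda>x. u x - f x) < 2 * b" "l2norm M (\<lambda>x. lie_deriv u x - g x) < 3 * b"
proof -
  define K where "K = (growth t + 1) * (1 + 1 / \<bar>t\<bar>)"
  have K: "K > 0" "growth t \<le> K" "(growth t + 1) / \<bar>t\<bar> \<le> K"
    using growth_ge_1[of t] \<open>t \<noteq> 0\<close> by (auto simp: K_def field_simps intro: add_pos_nonneg)
  obtain v where v: "C1c v" "l2norm M (\<lambda>x. v x - f x) < b / K"
    by (rule C1c_dense[OF f, of "b / K"]) (use \<open>b > 0\<close> K(1) that in auto)
  then have Kv: "K * l2norm M (\<lambda>x. v x - f x) < b" using K(1) by (simp add: field_simps)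
  obtain n where n: "n > 0" "l2norm M (\<lambda>x. flow_average n t (lie_deriv v) x - flow_quotient t v x) < b"
    by (rule LIMSEQ_null_lessE[OF flow_average_lie_deriv_tendsto[OF v(1) \<open>t \<noteq> 0\<close>] \<open>b > 0\<close>]) (rule that)
  note v_L2 = C1c_L2[OF v(1)] and lie_L2 = lie_deriv_L2[OF v(1)]
  show thesis
  proof (rule that[of "flow_average n t v"])
    show "C1c (flow_average n t v)" by (rule C1c_flow_average[OF v(1)])
    have "l2norm M (\<lambda>x. flow_average n t v x - f x) \<le> growth t * l2norm M (\<lambda>x. v x - f x) + b"
      by (intro l2norm_flow_average_diff_le orbit v_L2 f \<open>n > 0\<close>)
    moreover have "growth t * l2norm M (\<lambda>x. v x - f x) \<le> K * l2norm M (\<lambda>x. v x - f x)"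
      using K(2) by (intro mult_right_mono) auto
    ultimately show "l2norm M (\<lambda>x. flow_average n t v x - f x) < 2 * b" using Kv by linarith
    have "l2norm M (\<lambda>x. flow_average n t (lie_deriv v) x - g x)
        \<le> l2norm M (\<lambda>x. flow_average n t (lie_deriv v) x - flow_quotient t v x)
          + l2norm M (\<lambda>x. flow_quotient t v x - g x)"
      by (intro l2norm_diff_triangle flow_average_L2 flow_quotient_L2 v_L2 lie_L2 g)
    moreover have "l2norm M (\<lambda>x. flow_quotient t v x - g x)
        \<le> l2norm M (\<lambda>x. flow_quotient t v x - flow_quotient t f x) + l2norm M (\<lambda>x. flow_quotient t f x - g x)"
      by (intro l2norm_diff_triangle flow_quotient_L2 v_L2 f g)
    moreover have "l2norm M (\<lambda>x. flow_quotient t v x - flow_quotient t f x) \<le> K * l2norm M (\<lambda>x. v x - f x)"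
      using l2norm_flow_quotient_diff_le[OF v_L2 f, of t]
        mult_right_mono[OF K(3) l2norm_nonneg[of M "\<lambda>x. v x - f x"]] by simp
    ultimately show "l2norm M (\<lambda>x. lie_deriv (flow_average n t v) x - g x) < 3 * b"
      unfolding lie_deriv_flow_average[OF v(1)] using n(2) quotient Kv by linarith
  qed
qed

lemma generator_graph_approx:
  assumes gen: "generator_rel M (\<lambda>t f x. f (\<phi> t x)) f g" and "e > 0"
  obtains u where "C1c u" "l2norm M (\<lambda>x. u x - f x) < e" "l2norm M (\<lambda>x. lie_deriv u x - g x) < e"
proof -
  have f: "f \<in> L2 M" and g: "g \<in> L2 M"
    and quotient: "((\<lambda>t. l2norm M (\<lambda>x. flow_quotient t f x - g x)) \<longlongrightarrow> 0) (at 0)"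
    using gen by (auto simp: generator_rel_def)
  have "e / 3 > 0" using \<open>e > 0\<close> by simp
  obtain \<tau> where "\<tau> > 0" and \<tau>: "\<And>s. \<bar>s\<bar> < \<tau> \<Longrightarrow> l2norm M (\<lambda>x. f (\<phi> s x) - f x) < e / 3"
    by (rule strongly_continuousE[OF f \<open>e / 3 > 0\<close>]) (rule that)
  have "\<forall>\<^sub>F t in at 0. l2norm M (\<lambda>x. flow_quotient t f x - g x) < e / 3"
    by (rule order_tendstoD(2)[OF quotient \<open>e / 3 > 0\<close>])
  moreover have "\<forall>\<^sub>F t::real in at 0. t \<noteq> 0 \<and> \<bar>t\<bar> < \<tau>"
    using eventually_norm_scaleR_less[OF \<open>\<tau> > 0\<close>, of "1::real"] by simp
  ultimately obtain t where t: "l2norm M (\<lambda>x. flow_quotient t f x - g x) < e / 3" "t \<noteq> 0" "\<bar>t\<bar> < \<tau>"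
    using eventually_happens'[OF at_neq_bot eventually_conj] by blast
  have "l2norm M (\<lambda>x. f (\<phi> s x) - f x) \<le> e / 3" if "\<bar>s\<bar> \<le> \<bar>t\<bar>" for s
    using \<tau>[of s] that t(3) by simp
  from flow_average_graph_approx[OF f g t(2) \<open>e / 3 > 0\<close> this less_imp_le[OF t(1)]]
  obtain u where "C1c u" "l2norm M (\<lambda>x. u x - f x) < 2 * (e / 3)" "l2norm M (\<lambda>x. lie_deriv u x - g x) < 3 * (e / 3)"
    by blast
  then show thesis using \<open>e > 0\<close> by (intro that) auto
qed

lemma generator_imp_closure:
  assumes gen: "generator_rel M (\<lambda>t f x. f (\<phi> t x)) f g"
  shows "closure_rel M F f g"
proof -
  have "\<exists>u. C1c u \<and> l2norm M (\<lambda>x. u x - f x) < 1 / real (Suc k) \<and>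
      l2norm M (\<lambda>x. lie_deriv u x - g x) < 1 / real (Suc k)" for k
    by (rule generator_graph_approx[OF gen, of "1 / real (Suc k)"]) auto
  then have "\<exists>u. \<forall>k. C1c (u k) \<and> l2norm M (\<lambda>x. u k x - f x) < 1 / real (Suc k) \<and>
      l2norm M (\<lambda>x. lie_deriv (u k) x - g x) < 1 / real (Suc k)"
    by (intro choice allI)
  then obtain u where u: "\<And>k. C1c (u k)" "\<And>k. l2norm M (\<lambda>x. u k x - f x) < 1 / real (Suc k)"
    "\<And>k. l2norm M (\<lambda>x. lie_deriv (u k) x - g x) < 1 / real (Suc k)"
    by blast
  note null = Lim_null_comparison[OF always_eventually LIMSEQ_Suc[OF lim_1_over_n]]
  have "(\<lambda>k. l2norm M (\<lambda>x. u k x - f x)) \<longlonglongrightarrow> 0"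
    by (rule null) (use u(2) less_imp_le in auto)
  moreover have "(\<lambda>k. l2norm M (\<lambda>x. lie_deriv (u k) x - g x)) \<longlonglongrightarrow> 0"
    by (rule null) (use u(3) less_imp_le in auto)
  moreover have "f \<in> L2 M" "g \<in> L2 M" using gen by (auto simp: generator_rel_def)
  ultimately show ?thesis unfolding closure_rel_def using u(1) by blast
qed

lemma l2norm_flow_eq:
  assumes "c = 0" and f: "f \<in> L2 M"
  shows "l2norm M (\<lambda>x. f (\<phi> t x)) = l2norm M f"
proof (rule antisym)
  have growth: "growth s = 1" for s unfolding growth_def by (simp add: \<open>c = 0\<close>)
  show "l2norm M (\<lambda>x. f (\<phi> t x)) \<le> l2norm M f"
    using l2norm_flow_le[OF f, of t] by (simp add: growth)
  show "l2norm M f \<le> l2norm M (\<lambda>x. f (\<phi> t x))"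
    using l2norm_flow_le[OF flow_L2[OF f, of t], of "-t"] by (simp add: growth)
qed

lemma emeasure_flow_vimage_eq:
  assumes "c = 0" and A: "A \<in> sets lebesgue"
  shows "emeasure M (\<phi> t -` A) = emeasure M A"
proof (rule antisym)
  show "emeasure M (\<phi> t -` A) \<le> emeasure M A"
    using emeasure_flow_vimage_le[OF A, of t] \<open>c = 0\<close> by simp
  have "\<phi> (-t) -` (\<phi> t -` A) = A" by (auto simp: vimage_def)
  then show "emeasure M A \<le> emeasure M (\<phi> t -` A)"
    using emeasure_flow_vimage_le[OF flow_vimage_sets[OF A, of t], of "-t"] \<open>c = 0\<close> by simp
qed

lemma integral_flow_tendsto:
  fixes d f :: "real^'n \<Rightarrow> real"
  assumes d: "integrable M d" and u: "\<And>k::nat. u k \<in> borel_measurable lebesgue" "\<And>k x. \<bar>u k x\<bar> \<le> B"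
    and f: "f \<in> borel_measurable lebesgue" and lim: "AE x in M. (\<lambda>k. u k x) \<longlonglongrightarrow> f x"
  shows "(\<lambda>k. \<integral>x. d x * u k (\<phi> t x) \<partial>M) \<longlonglongrightarrow> (\<integral>x. d x * f (\<phi> t x) \<partial>M)"
proof (rule integral_dominated_convergence)
  have d_meas: "d \<in> borel_measurable M" using d by auto
  show "(\<lambda>x. d x * f (\<phi> t x)) \<in> borel_measurable M"
    using flow_compose_measurable[OF f] by (intro borel_measurable_times d_meas) (simp add: borel_measurable_M)
  show "(\<lambda>x. d x * u k (\<phi> t x)) \<in> borel_measurable M" for k
    using flow_compose_measurable[OF u(1)] by (intro borel_measurable_times d_meas) (simp add: borel_measurable_M)
  show "integrable M (\<lambda>x. \<bar>d x\<bar> * B)" using d by (intro integrable_mult_left integrable_abs)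
  show "AE x in M. (\<lambda>k. d x * u k (\<phi> t x)) \<longlonglongrightarrow> d x * f (\<phi> t x)"
    using flow_AE[OF lim, of t] by eventually_elim (rule tendsto_mult_left)
  show "AE x in M. norm (d x * u k (\<phi> t x)) \<le> \<bar>d x\<bar> * B" for k
    using u(2) by (intro AE_I2) (simp add: abs_mult mult_left_mono)
qed

lemma integral_flow_continuousE:
  assumes d: "integrable M d" and f: "f \<in> L2 M" "\<And>x. \<bar>f x\<bar> \<le> B" and "e > 0"
  obtains \<tau> C where "\<tau> > 0" "\<And>u s. u \<in> L2 M \<Longrightarrow> (\<And>x. \<bar>u x\<bar> \<le> B) \<Longrightarrow> \<bar>s\<bar> < \<tau> \<Longrightarrow>
    \<bar>(\<integral>x. d x * u (\<phi> s x) \<partial>M) - (\<integral>x. d x * f x \<partial>M)\<bar> \<le> e + C * l2norm M (\<lambda>x. u x - f x)"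
proof -
  have "e / 2 > 0" using \<open>e > 0\<close> by simp
  then obtain e' where e': "e' > 0" "e' * (2 * B) < e / 2"
    by (rule pos_mult_lessE) (rule that)
  obtain C where "C \<ge> 0" and C: "\<And>w B. w \<in> L2 M \<Longrightarrow> (\<And>x. \<bar>w x\<bar> \<le> B) \<Longrightarrow>
      \<bar>\<integral>x. d x * w x \<partial>M\<bar> \<le> e' * B + C * l2norm M w"
    using L1_pairing_L2_bound[OF d e'(1)] by blast
  obtain \<epsilon> where \<epsilon>: "\<epsilon> > 0" "\<epsilon> * C < e / 2"
    by (rule pos_mult_lessE[OF \<open>e / 2 > 0\<close>]) (rule that)
  obtain \<tau> where "\<tau> > 0" and \<tau>: "\<And>s. \<bar>s\<bar> < \<tau> \<Longrightarrow> l2norm M (\<lambda>x. f (\<phi> s x) - f x) < \<epsilon>"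
    by (rule strongly_continuousE[OF f(1) \<epsilon>(1)]) (rule that)
  show thesis
  proof (rule that)
    show "min 1 \<tau> > 0" using \<open>\<tau> > 0\<close> by simp
    fix u s assume u: "u \<in> L2 M" "\<And>x. \<bar>u x\<bar> \<le> B" and s: "\<bar>s\<bar> < min 1 \<tau>"
    let ?w = "\<lambda>x. u (\<phi> s x) - f x"
    have "\<bar>?w x\<bar> \<le> 2 * B" for x using u(2)[of "\<phi> s x"] f(2)[of x] by linarith
    then have "\<bar>\<integral>x. d x * ?w x \<partial>M\<bar> \<le> e' * (2 * B) + C * l2norm M ?w"
      by (intro C L2_diff flow_L2 u f)
    also have "(\<integral>x. d x * ?w x \<partial>M) = (\<integral>x. d x * u (\<phi> s x) \<partial>M) - (\<integral>x. d x * f x \<partial>M)"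
      using integrable_mult_bounded[OF d L2_measurable[OF flow_L2[OF u(1)]] u(2)]
        integrable_mult_bounded[OF d L2_measurable[OF f(1)] f(2)]
      by (simp add: right_diff_distrib)
    finally have pairing: "\<bar>(\<integral>x. d x * u (\<phi> s x) \<partial>M) - (\<integral>x. d x * f x \<partial>M)\<bar> \<le> e / 2 + C * l2norm M ?w"
      using e'(2) by linarith
    have "l2norm M ?w \<le> growth s * l2norm M (\<lambda>x. u x - f x) + \<epsilon>"
      using l2norm_flow_diff_le[OF u(1) f(1), of s] \<tau>[of s] s by simp
    also have "\<dots> \<le> growth 1 * l2norm M (\<lambda>x. u x - f x) + \<epsilon>"
      using s by (intro add_right_mono mult_right_mono growth_mono) auto
    finally have "C * l2norm M ?w \<le> C * growth 1 * l2norm M (\<lambda>x. u x - f x) + C * \<epsilon>"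
      using mult_left_mono[OF _ \<open>C \<ge> 0\<close>] by (fastforce simp: distrib_left mult.assoc)
    with pairing \<epsilon>(2)[unfolded mult.commute[of \<epsilon>]] show "\<bar>(\<integral>x. d x * u (\<phi> s x) \<partial>M) - (\<integral>x. d x * f x \<partial>M)\<bar>
        \<le> e + C * growth 1 * l2norm M (\<lambda>x. u x - f x)" by linarith
  qed
qed

end

section \<open>Transport of densities along the flow\<close>

lemma (in prob_space) esssup_nonneg:
  fixes f :: "'a \<Rightarrow> ereal"
  assumes "\<And>x. f x \<ge> 0"
  shows "esssup M f \<ge> 0"
  using esssup_mono[of "\<lambda>_. 0" M f] esssup_const[of M "0::ereal"] assms by (simp add: emeasure_space_1)

lemma (in c1_flow_vec) koopman_lebesgue: "koopman F F' L \<phi> lebesgue (real CARD('n) * L)"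
proof
  show "emeasure lebesgue (\<phi> t -` A) \<le> ennreal (exp (real CARD('n) * L * \<bar>t\<bar>)) * emeasure lebesgue A"
    if "A \<in> sets lebesgue" for A t
    using emeasure_lebesgue_flow_vimage_le[OF that, of t] by simp
  show "emeasure lebesgue (cball (0::real^'n) R) < \<infinity>" for R
    using emeasure_lborel_cball_finite[of "0::real^'n" R] by simp
qed (simp_all add: absolutely_continuous_def L_nonneg)

locale flow_density = c1_flow_vec F F' L \<phi>
  for F :: "real^'n \<Rightarrow> real^'n" and F' :: "real^'n \<Rightarrow> (real^'n) \<Rightarrow>\<^sub>L (real^'n)"
    and L :: real and \<phi> :: "real \<Rightarrow> real^'n \<Rightarrow> real^'n" +
  fixes \<rho> d :: "real^'n \<Rightarrow> real"
  assumes \<rho>_int: "integrable lebesgue \<rho>" and \<rho>_nonneg: "\<And>x. \<rho> x \<ge> 0"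
    and weak_div_d: "weak_div (\<lambda>x. \<rho> x *\<^sub>R F x) d"
begin

sublocale leb: koopman F F' L \<phi> lebesgue "real CARD('n) * L"
  by (rule koopman_lebesgue)

lemma d_int: "integrable lebesgue d"
  using weak_div_d by (simp add: weak_div_def)

lemma integral_lie_deriv:
  "C1c u \<Longrightarrow> (\<integral>x. \<rho> x * lie_deriv u x \<partial>lebesgue) = - (\<integral>x. d x * u x \<partial>lebesgue)"
  using weak_div_d by (simp add: weak_div_def)

lemma C1c_flow_integrable:
  assumes "integrable lebesgue r" and u: "C1c u"
  shows "integrable lebesgue (\<lambda>x. r x * u (\<phi> t x))"
proof -
  obtain B where "\<And>x. \<bar>u x\<bar> \<le> B" by (rule C1c_boundedE[OF u]) (rule that)
  then show ?thesis
    by (intro integrable_mult_bounded[where B = B] assms flow_compose_measurable C1c_measurable)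
qed

lemma transport_deriv:
  assumes u: "C1c u"
  shows "((\<lambda>t. \<integral>x. \<rho> x * u (\<phi> t x) \<partial>lebesgue) has_real_derivative
           - (\<integral>x. d x * u (\<phi> t x) \<partial>lebesgue)) (at t)"
proof -
  define v where "v = (\<lambda>x. u (\<phi> t x))"
  have v: "C1c v" unfolding v_def by (rule C1c_flow[OF u])
  obtain B where B: "\<And>x. \<bar>lie_deriv v x\<bar> \<le> B" by (rule lie_deriv_boundedE[OF v]) (rule that)
  have \<rho>_meas: "\<rho> \<in> borel_measurable lebesgue" using \<rho>_int by auto
  have "((\<lambda>h. \<integral>x. \<rho> x * flow_quotient h v x \<partial>lebesgue) \<longlongrightarrow> (\<integral>x. \<rho> x * lie_deriv v x \<partial>lebesgue)) (at 0)"
  proof (rule integral_dominated_convergence_at)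
    show "(\<lambda>x. \<rho> x * lie_deriv v x) \<in> borel_measurable lebesgue"
      by (intro borel_measurable_times \<rho>_meas lie_deriv_measurable v)
    show "(\<lambda>x. \<rho> x * flow_quotient h v x) \<in> borel_measurable lebesgue" for h
      by (intro borel_measurable_times \<rho>_meas L2_measurable leb.flow_quotient_L2 leb.C1c_L2 v)
    show "integrable lebesgue (\<lambda>x. \<rho> x * B)" by (rule integrable_mult_left[OF \<rho>_int])
    show "AE x in lebesgue. ((\<lambda>h. \<rho> x * flow_quotient h v x) \<longlongrightarrow> \<rho> x * lie_deriv v x) (at 0)"
      by (intro AE_I2 tendsto_mult_left flow_quotient_tendsto v)
    have "norm (\<rho> x * flow_quotient h v x) \<le> \<rho> x * B" for h x
      unfolding real_norm_def abs_mult abs_of_nonneg[OF \<rho>_nonneg]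
      by (intro mult_left_mono abs_flow_quotient_le v B \<rho>_nonneg)
    then show "\<forall>\<^sub>F h in at 0. AE x in lebesgue. norm (\<rho> x * flow_quotient h v x) \<le> \<rho> x * B"
      by (intro always_eventually allI AE_I2)
  qed
  moreover have "(\<integral>x. \<rho> x * flow_quotient h v x \<partial>lebesgue) =
      ((\<integral>x. \<rho> x * u (\<phi> (t + h) x) \<partial>lebesgue) - (\<integral>x. \<rho> x * u (\<phi> t x) \<partial>lebesgue)) / h" for h
  proof -
    have "(\<integral>x. \<rho> x * flow_quotient h v x \<partial>lebesgue)
        = (\<integral>x. (\<rho> x * u (\<phi> (t + h) x) - \<rho> x * u (\<phi> t x)) / h \<partial>lebesgue)"
      by (simp add: v_def flow_flow right_diff_distrib)
    then show ?thesis using C1c_flow_integrable[OF \<rho>_int u] by simp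
  qed
  moreover have "(\<integral>x. \<rho> x * lie_deriv v x \<partial>lebesgue) = - (\<integral>x. d x * u (\<phi> t x) \<partial>lebesgue)"
    unfolding integral_lie_deriv[OF v] by (simp add: v_def)
  ultimately show ?thesis unfolding DERIV_def by (simp only:)
qed

lemma transport_increment_le:
  assumes u: "C1c u" and b: "\<And>s. \<bar>s\<bar> \<le> \<bar>t\<bar> \<Longrightarrow> \<bar>(\<integral>x. d x * u (\<phi> s x) \<partial>lebesgue) - a\<bar> \<le> b"
  shows "\<bar>(\<integral>x. \<rho> x * u (\<phi> t x) \<partial>lebesgue) - (\<integral>x. \<rho> x * u x \<partial>lebesgue) + t * a\<bar> \<le> b * \<bar>t\<bar>"
proof -
  define m where "m s = (\<integral>x. \<rho> x * u (\<phi> s x) \<partial>lebesgue) + s * a" for s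
  have "norm (m t - m 0) \<le> b * norm (t - 0)"
  proof (rule field_differentiable_bound[of "{-\<bar>t\<bar>..\<bar>t\<bar>}"])
    fix s assume s: "s \<in> {-\<bar>t\<bar>..\<bar>t\<bar>}"
    have "(m has_real_derivative - (\<integral>x. d x * u (\<phi> s x) \<partial>lebesgue) + 1 * a) (at s)"
      unfolding m_def by (intro DERIV_add transport_deriv u DERIV_cmult_right DERIV_ident)
    then show "(m has_real_derivative - (\<integral>x. d x * u (\<phi> s x) \<partial>lebesgue) + 1 * a) (at s within {-\<bar>t\<bar>..\<bar>t\<bar>})"
      by (rule has_field_derivative_at_within)
    show "norm (- (\<integral>x. d x * u (\<phi> s x) \<partial>lebesgue) + 1 * a) \<le> b"
      using b[of s] s by (auto simp: abs_le_iff)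
  qed auto
  then show ?thesis by (simp add: m_def algebra_simps)
qed

lemma transport_deriv_bounded_support:
  assumes f: "f \<in> borel_measurable lebesgue" "\<And>x. \<bar>f x\<bar> \<le> B" "\<And>x. norm x > R \<Longrightarrow> f x = 0"
    and "R \<ge> 0"
  shows "((\<lambda>t. \<integral>x. \<rho> x * f (\<phi> t x) \<partial>lebesgue) has_real_derivative
           - (\<integral>x. d x * f x \<partial>lebesgue)) (at 0)"
  unfolding has_field_derivative_def has_derivative_at_alt
proof (intro conjI allI impI bounded_linear_mult_right)
  define a where "a = (\<integral>x. d x * f x \<partial>lebesgue)"
  define m where "m w t = (\<integral>x. \<rho> x * w (\<phi> t x) \<partial>lebesgue)" for w t
  obtain u where u: "\<And>k::nat. C1c (u k)" "\<And>k x. \<bar>u k x\<bar> \<le> B + 1"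
    and lim: "AE x in lebesgue. (\<lambda>k. u k x) \<longlonglongrightarrow> f x" "(\<lambda>k. l2norm lebesgue (\<lambda>x. u k x - f x)) \<longlonglongrightarrow> 0"
    using leb.bounded_measurable_approx_C1c_L2[OF f \<open>R \<ge> 0\<close>] by blast
  have m_lim: "(\<lambda>k. m (u k) t) \<longlonglongrightarrow> m f t" for t
    unfolding m_def by (rule leb.integral_flow_tendsto[OF \<rho>_int C1c_measurable[OF u(1)] u(2) f(1) lim(1)])
  have f_L2: "f \<in> L2 lebesgue" "\<bar>f x\<bar> \<le> B + 1" for x
    using leb.bounded_support_L2[OF f] f(2)[of x] by auto
  fix e :: real assume "e > 0"
  obtain \<tau> C where "\<tau> > 0" and \<tau>: "\<And>w s. w \<in> L2 lebesgue \<Longrightarrow> (\<And>x. \<bar>w x\<bar> \<le> B + 1) \<Longrightarrow> \<bar>s\<bar> < \<tau> \<Longrightarrow>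
      \<bar>(\<integral>x. d x * w (\<phi> s x) \<partial>lebesgue) - a\<bar> \<le> e + C * l2norm lebesgue (\<lambda>x. w x - f x)"
    using leb.integral_flow_continuousE[OF d_int f_L2 \<open>e > 0\<close>, folded a_def] by blast
  have "\<bar>m f t - m f 0 + t * a\<bar> \<le> e * \<bar>t\<bar>" if t: "\<bar>t\<bar> < \<tau>" for t
  proof (rule LIMSEQ_le)
    show "(\<lambda>k. \<bar>m (u k) t - m (u k) 0 + t * a\<bar>) \<longlonglongrightarrow> \<bar>m f t - m f 0 + t * a\<bar>"
      by (intro tendsto_intros m_lim)
    have "(\<lambda>k. (e + C * l2norm lebesgue (\<lambda>x. u k x - f x)) * \<bar>t\<bar>) \<longlonglongrightarrow> (e + C * 0) * \<bar>t\<bar>"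
      by (intro tendsto_intros lim)
    then show "(\<lambda>k. (e + C * l2norm lebesgue (\<lambda>x. u k x - f x)) * \<bar>t\<bar>) \<longlonglongrightarrow> e * \<bar>t\<bar>" by simp
    have "\<bar>m (u k) t - m (u k) 0 + t * a\<bar> \<le> (e + C * l2norm lebesgue (\<lambda>x. u k x - f x)) * \<bar>t\<bar>" for k
      unfolding m_def flow0 using t by (intro transport_increment_le \<tau> leb.C1c_L2 u) auto
    then show "\<exists>N. \<forall>k\<ge>N. \<bar>m (u k) t - m (u k) 0 + t * a\<bar> \<le> (e + C * l2norm lebesgue (\<lambda>x. u k x - f x)) * \<bar>t\<bar>"
      by blast
  qed
  with \<open>\<tau> > 0\<close> show "\<exists>\<tau>>0. \<forall>t. norm (t - 0) < \<tau> \<longrightarrow>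
      norm ((\<integral>x. \<rho> x * f (\<phi> t x) \<partial>lebesgue) - (\<integral>x. \<rho> x * f (\<phi> 0 x) \<partial>lebesgue) - - (\<integral>x. d x * f x \<partial>lebesgue) * (t - 0))
        \<le> e * norm (t - 0)"
    by (intro exI[of _ \<tau>]) (auto simp: m_def a_def mult.commute)
qed

lemma integral_div_eq_0_if_density_vanishes:
  assumes f: "f \<in> borel_measurable lebesgue" "\<And>x. \<bar>f x\<bar> \<le> B" "\<And>x. norm x > R \<Longrightarrow> f x = 0"
    and "R \<ge> 0" and "\<And>x. 0 \<le> f x" and vanish: "\<And>x. \<rho> x * f x = 0"
  shows "(\<integral>x. d x * f x \<partial>lebesgue) = 0"
proof -
  let ?m = "\<lambda>t. \<integral>x. \<rho> x * f (\<phi> t x) \<partial>lebesgue"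
  have "?m 0 \<le> ?m t" for t
    using \<rho>_nonneg assms(5) by (simp add: vanish)
  then have "- (\<integral>x. d x * f x \<partial>lebesgue) = 0"
    by (intro DERIV_local_min[OF transport_deriv_bounded_support[OF f \<open>R \<ge> 0\<close>], of 1]) auto
  then show ?thesis by simp
qed

lemma div_eq_0_where_density_eq_0: "AE x in lebesgue. \<rho> x = 0 \<longrightarrow> d x = 0"
proof -
  have [measurable]: "d \<in> borel_measurable lebesgue" "\<rho> \<in> borel_measurable lebesgue"
    using d_int \<rho>_int by auto
  have one_sided: "AE x in lebesgue. norm x \<le> real n \<and> \<rho> x = 0 \<longrightarrow> \<sigma> * d x \<le> 0" for n :: nat and \<sigma> :: real
  proof -
    define f where "f x = (if norm x \<le> real n \<and> \<rho> x = 0 \<and> \<sigma> * d x > 0 then 1 else 0 :: real)" for x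
    have [measurable]: "(norm :: real^'n \<Rightarrow> real) \<in> borel_measurable lebesgue"
      by (intro continuous_borel_measurable_lebesgue continuous_intros)
    have f_meas: "f \<in> borel_measurable lebesgue" unfolding f_def by measurable
    have "(\<integral>x. d x * f x \<partial>lebesgue) = 0"
      by (rule integral_div_eq_0_if_density_vanishes[OF f_meas, of 1 "real n"]) (auto simp: f_def)
    then have "(\<integral>x. \<sigma> * (d x * f x) \<partial>lebesgue) = 0" by simp
    moreover have "integrable lebesgue (\<lambda>x. \<sigma> * (d x * f x))"
      by (intro integrable_mult_right integrable_mult_bounded[OF d_int f_meas, of 1]) (simp add: f_def)
    ultimately have "AE x in lebesgue. \<sigma> * (d x * f x) = 0"
      by (subst (asm) integral_nonneg_eq_0_iff_AE) (auto simp: f_def)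
    then show ?thesis by eventually_elim (auto simp: f_def split: if_splits)
  qed
  have "AE x in lebesgue. \<forall>n::nat. (norm x \<le> real n \<and> \<rho> x = 0 \<longrightarrow> 1 * d x \<le> 0) \<and>
      (norm x \<le> real n \<and> \<rho> x = 0 \<longrightarrow> (-1) * d x \<le> 0)"
    unfolding AE_all_countable by (intro allI AE_conjI one_sided)
  then show ?thesis
  proof eventually_elim
    case (elim x)
    obtain n where "norm x \<le> real n" using real_arch_simple by blast
    with elim show ?case by force
  qed
qed

lemma transport_bound_C1c:
  assumes c: "c \<ge> 0" "AE x in lebesgue. \<bar>d x\<bar> \<le> c * \<rho> x" and u: "C1c u" "\<And>x. u x \<ge> 0"
  shows "(\<integral>x. \<rho> x * u (\<phi> t x) \<partial>lebesgue) \<le> exp (c * \<bar>t\<bar>) * (\<integral>x. \<rho> x * u x \<partial>lebesgue)"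
proof -
  have "\<bar>- (\<integral>x. d x * u (\<phi> s x) \<partial>lebesgue)\<bar> \<le> c * (\<integral>x. \<rho> x * u (\<phi> s x) \<partial>lebesgue) + 0" for s
  proof -
    have "\<bar>- (\<integral>x. d x * u (\<phi> s x) \<partial>lebesgue)\<bar> \<le> (\<integral>x. \<bar>d x * u (\<phi> s x)\<bar> \<partial>lebesgue)" by simp
    also have "\<dots> \<le> (\<integral>x. c * (\<rho> x * u (\<phi> s x)) \<partial>lebesgue)"
    proof (rule integral_mono_AE)
      show "AE x in lebesgue. \<bar>d x * u (\<phi> s x)\<bar> \<le> c * (\<rho> x * u (\<phi> s x))"
        using c(2) by eventually_elim (use u(2) in \<open>simp add: abs_mult mult.assoc[symmetric] mult_right_mono\<close>)
    qed (intro integrable_abs integrable_mult_right C1c_flow_integrable d_int \<rho>_int u)+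
    finally show ?thesis by simp
  qed
  from gronwall[OF transport_deriv[OF u(1)] this c(1)] show ?thesis by simp
qed

lemma emeasure_density_integral:
  assumes "A \<in> sets lebesgue"
  shows "emeasure (density lebesgue \<rho>) A = ennreal (\<integral>x. \<rho> x * indicator A x \<partial>lebesgue)"
proof -
  have "emeasure (density lebesgue \<rho>) A = (\<integral>\<^sup>+x. ennreal (\<rho> x * indicator A x) \<partial>lebesgue)"
    using assms \<rho>_int by (subst emeasure_density) (auto intro!: nn_integral_cong simp: indicator_def)
  also have "\<dots> = ennreal (\<integral>x. \<rho> x * indicator A x \<partial>lebesgue)"
    using assms \<rho>_nonneg by (intro nn_integral_eq_integral integrable_real_mult_indicator \<rho>_int) auto
  finally show ?thesis .
qed

lemma emeasure_flow_vimage_le_bounded: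
  assumes c: "c \<ge> 0" "AE x in lebesgue. \<bar>d x\<bar> \<le> c * \<rho> x" and A: "A \<in> sets lebesgue" "A \<subseteq> cball 0 R" "R \<ge> 0"
  shows "emeasure (density lebesgue \<rho>) (\<phi> t -` A) \<le> ennreal (exp (c * \<bar>t\<bar>)) * emeasure (density lebesgue \<rho>) A"
proof -
  have A_meas: "(indicator A :: real^'n \<Rightarrow> real) \<in> borel_measurable lebesgue" using A(1) by simp
  obtain v where v: "\<And>k::nat. C1c (v k)" "\<And>k x. \<bar>v k x\<bar> \<le> 1 + 1"
    "AE x in lebesgue. (\<lambda>k. v k x) \<longlonglongrightarrow> indicator A x"
    by (rule bounded_measurable_approx_C1c[OF A_meas, of 1 R]) (use A that in \<open>auto simp: indicator_def\<close>)
  define u where "u k x = v k x * v k x" for k x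
  have u: "C1c (u k)" "u k x \<ge> 0" "\<bar>u k x\<bar> \<le> 4" for k x
    using C1c_mult[OF v(1) C1c_imp_C1[OF v(1)], of k k] mult_mono[OF v(2)[of k x] v(2)[of k x]]
    by (auto simp: u_def[abs_def] abs_mult)
  have u_lim: "AE x in lebesgue. (\<lambda>k. u k x) \<longlonglongrightarrow> indicator A x"
    using v(3)
  proof eventually_elim
    case (elim x)
    from tendsto_mult[OF elim elim] show ?case by (simp add: u_def indicator_inter_arith[symmetric])
  qed
  note lim = leb.integral_flow_tendsto[OF \<rho>_int C1c_measurable[OF u(1)] u(3) A_meas u_lim]
  have "(\<integral>x. \<rho> x * indicator A (\<phi> t x) \<partial>lebesgue) \<le> exp (c * \<bar>t\<bar>) * (\<integral>x. \<rho> x * indicator A x \<partial>lebesgue)"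
  proof (rule LIMSEQ_le[OF lim])
    show "(\<lambda>k. exp (c * \<bar>t\<bar>) * (\<integral>x. \<rho> x * u k x \<partial>lebesgue)) \<longlonglongrightarrow> exp (c * \<bar>t\<bar>) * (\<integral>x. \<rho> x * indicator A x \<partial>lebesgue)"
      using tendsto_mult_left[OF lim[of 0]] by simp
  qed (use transport_bound_C1c[OF c u(1,2)] in blast)
  then show ?thesis
    using flow_vimage_sets[OF A(1), of t] A(1)
    by (simp add: emeasure_density_integral ennreal_mult'[symmetric] ennreal_leI indicator_vimage)
qed

lemma koopman_density:
  assumes c: "c \<ge> 0" "AE x in lebesgue. \<bar>d x\<bar> \<le> c * \<rho> x"
  shows "koopman F F' L \<phi> (density lebesgue \<rho>) c"
proof
  let ?P = "density lebesgue \<rho>"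
  show "absolutely_continuous lebesgue ?P"
    using \<rho>_int by (intro absolutely_continuousI_density) auto
  show "emeasure ?P (cball 0 R) < \<infinity>" for R
    by (simp add: emeasure_density_integral)
  show "emeasure ?P (\<phi> t -` A) \<le> ennreal (exp (c * \<bar>t\<bar>)) * emeasure ?P A" if A: "A \<in> sets lebesgue" for A t
  proof (rule LIMSEQ_le_const2)
    let ?A = "\<lambda>n. A \<inter> cball 0 (real n)"
    have sets: "?A n \<in> sets lebesgue" for n
      by (intro sets.Int A) simp
    have "(\<lambda>n. emeasure ?P (\<phi> t -` ?A n)) \<longlonglongrightarrow> emeasure ?P (\<Union>n. \<phi> t -` ?A n)"
      using flow_vimage_sets[OF sets] by (intro Lim_emeasure_incseq) (auto simp: incseq_def simp del: vimage_Int)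
    moreover have "(\<Union>n. \<phi> t -` ?A n) = \<phi> t -` A"
      using real_arch_simple by auto
    ultimately show "(\<lambda>n. emeasure ?P (\<phi> t -` ?A n)) \<longlonglongrightarrow> emeasure ?P (\<phi> t -` A)" by simp
    have "emeasure ?P (\<phi> t -` ?A n) \<le> ennreal (exp (c * \<bar>t\<bar>)) * emeasure ?P A" for n
      by (rule order_trans[OF emeasure_flow_vimage_le_bounded[OF c sets, of n "real n" t]])
        (use A in \<open>auto intro!: mult_left_mono emeasure_mono\<close>)
    then show "\<exists>N. \<forall>n\<ge>N. emeasure ?P (\<phi> t -` ?A n) \<le> ennreal (exp (c * \<bar>t\<bar>)) * emeasure ?P A" by blast
  qed
qed (simp_all add: c)

lemma abs_div_le_esssup_mult_density:
  assumes fin: "esssup (density lebesgue \<rho>) (\<lambda>x. ereal \<bar>d x / \<rho> x\<bar>) < \<infinity>"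
    and nonneg: "esssup (density lebesgue \<rho>) (\<lambda>x. ereal \<bar>d x / \<rho> x\<bar>) \<ge> 0"
  shows "AE x in lebesgue. \<bar>d x\<bar> \<le> real_of_ereal (esssup (density lebesgue \<rho>) (\<lambda>x. ereal \<bar>d x / \<rho> x\<bar>)) * \<rho> x"
proof -
  define E where "E = real_of_ereal (esssup (density lebesgue \<rho>) (\<lambda>x. ereal \<bar>d x / \<rho> x\<bar>))"
  have "esssup (density lebesgue \<rho>) (\<lambda>x. ereal \<bar>d x / \<rho> x\<bar>) = ereal E"
    using fin nonneg by (auto simp: E_def ereal_real)
  then have "AE x in density lebesgue \<rho>. \<bar>d x / \<rho> x\<bar> \<le> E"
    using esssup_AE[of "\<lambda>x. ereal \<bar>d x / \<rho> x\<bar>" "density lebesgue \<rho>"] by simp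
  then have "AE x in lebesgue. \<rho> x > 0 \<longrightarrow> \<bar>d x / \<rho> x\<bar> \<le> E"
    using \<rho>_int by (subst (asm) AE_density) auto
  with div_eq_0_where_density_eq_0 show ?thesis
    unfolding E_def[symmetric]
  proof eventually_elim
    case (elim x)
    then show ?case using \<rho>_nonneg[of x] by (cases "\<rho> x = 0") (auto simp: divide_le_eq)
  qed
qed

lemma koopman_density_esssup:
  assumes "(\<integral>x. \<rho> x \<partial>lebesgue) = 1"
    and fin: "esssup (density lebesgue \<rho>) (\<lambda>x. ereal \<bar>d x / \<rho> x\<bar>) < \<infinity>"
  shows "koopman F F' L \<phi> (density lebesgue \<rho>)
    (real_of_ereal (esssup (density lebesgue \<rho>) (\<lambda>x. ereal \<bar>d x / \<rho> x\<bar>)))"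
proof -
  interpret P: prob_space "density lebesgue \<rho>"
    by (rule prob_spaceI) (simp add: emeasure_density_integral[of UNIV, simplified] assms(1))
  have "esssup (density lebesgue \<rho>) (\<lambda>x. ereal \<bar>d x / \<rho> x\<bar>) \<ge> 0" by (rule P.esssup_nonneg) simp
  then show ?thesis
    by (intro koopman_density real_of_ereal_pos abs_div_le_esssup_mult_density fin)
qed

end

theorem theorem6:
  fixes \<rho> :: "real^'n \<Rightarrow> real"
    and F :: "real^'n \<Rightarrow> real^'n"
    and \<phi> :: "real \<Rightarrow> real^'n \<Rightarrow> real^'n"
    and d :: "real^'n \<Rightarrow> real"
    and P :: "(real^'n) measure"
    and \<omega>0 :: real
  assumes rho_meas: "\<rho> \<in> borel_measurable lebesgue"
    and rho_int: "integrable lebesgue \<rho>"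
    and rho_nonneg: "\<And>x. \<rho> x \<ge> 0"
    and rho_one: "(\<integral>x. \<rho> x \<partial>lebesgue) = 1"
    and P_def: "P = density lebesgue (\<lambda>x. ennreal (\<rho> x))"
    and F_C1: "\<exists>F' :: real^'n \<Rightarrow> ((real^'n) \<Rightarrow>\<^sub>L (real^'n)).
                 continuous_on UNIV F' \<and> bounded (range F') \<and>
                 (\<forall>x. (F has_derivative blinfun_apply (F' x)) (at x))"
    and flow0: "\<And>x. \<phi> 0 x = x"
    and flow_add: "\<And>s t. \<phi> (t + s) = \<phi> t \<circ> \<phi> s"
    and flow_deriv: "\<And>t x. ((\<lambda>t. \<phi> t x) has_vector_derivative F (\<phi> t x)) (at t)"
    and W11: "W11 (\<lambda>x. \<rho> x *\<^sub>R F x)"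
    and div: "weak_div (\<lambda>x. \<rho> x *\<^sub>R F x) d"
    and omega_fin: "esssup P (\<lambda>x. ereal \<bar>d x / \<rho> x\<bar>) < \<infinity>"
    and omega_def: "\<omega>0 = real_of_ereal (esssup P (\<lambda>x. ereal \<bar>d x / \<rho> x\<bar>)) / 2"
  shows "\<exists>U. sc_group P U
           \<and> (\<forall>f g. generator_rel P U f g \<longleftrightarrow> closure_rel P F f g)
           \<and> (\<forall>t. \<forall>f\<in>L2 P. l2norm P (U t f) \<le> exp (\<omega>0 * \<bar>t\<bar>) * l2norm P f)
           \<and> (\<forall>t u. C1c u \<longrightarrow> (AE x in P. U t u x = u (\<phi> t x)))
           \<and> ((AE x in lebesgue. d x = 0) \<longrightarrow>
                (\<forall>t. \<forall>f\<in>L2 P. l2norm P (U t f) = l2norm P f)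
              \<and> (\<forall>t. \<forall>A\<in>sets lebesgue. \<phi> t -` A \<in> sets lebesgue \<and>
                       emeasure P (\<phi> t -` A) = emeasure P A)
              \<and> (\<forall>t. \<forall>f\<in>L2 P. AE x in P. U t f x = f (\<phi> t x)))"
proof -
  obtain F' :: "real^'n \<Rightarrow> ((real^'n) \<Rightarrow>\<^sub>L (real^'n))" and L where F': "continuous_on UNIV F'"
    "\<And>x. norm (F' x) \<le> L" "\<And>x. (F has_derivative blinfun_apply (F' x)) (at x)"
    using F_C1 unfolding bounded_iff by auto
  interpret flow_density F F' L \<phi> \<rho> d
    by unfold_locales (use F' flow0 flow_add flow_deriv rho_int rho_nonneg div in auto)
  interpret K: koopman F F' L \<phi> P "2 * \<omega>0"
    using koopman_density_esssup[OF rho_one] omega_fin by (simp add: P_def omega_def)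
  have invariant: "koopman F F' L \<phi> P 0" if "AE x in lebesgue. d x = 0"
    unfolding P_def by (rule koopman_density) (use that in auto)
  show ?thesis
  proof (intro exI[of _ "\<lambda>t f x. f (\<phi> t x)"] conjI allI impI ballI)
    show "generator_rel P (\<lambda>t f x. f (\<phi> t x)) f g \<longleftrightarrow> closure_rel P F f g" for f g
      using K.closure_imp_generator K.generator_imp_closure by blast
    show "l2norm P (\<lambda>x. f (\<phi> t x)) \<le> exp (\<omega>0 * \<bar>t\<bar>) * l2norm P f" if "f \<in> L2 P" for t f
      using K.l2norm_flow_le[OF that, of t] by (simp add: K.growth_def)
  qed (use K.sc_group_flow flow_vimage_sets koopman.l2norm_flow_eq[OF invariant]
      koopman.emeasure_flow_vimage_eq[OF invariant] in auto)
qed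

end
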